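(* Let $k<i$ be positive cell indices of the same dimension $q$ (so $R_k=R_i=0$). Suppose that the interval $u\in\mathcal V^{(q)}$ with birth index $i(u)=i$ dies at $t=d_u<\infty$ and that the interval $v\in\mathcal V^{(q)}$ with birth index $i(v)=k$ survives beyond $t$ ($d_v>t$). For $a\in\Bbbk$ let $V'$ be the matrix with $V'_i=V_i+aV_k$ and $V'_\ell=V_\ell$ for $\ell\ne i$. Then, on replacing the factorization $(R,V)$ by $(R,V')$, the support of the transition coefficients can change while the reduced matrix, persistence pairs, and barcode remain unchanged. In particular, if $w_{uv}\ne0$ (computed from $(R,V)$), then choosing $a=-w_{uv}$ removes the edge $u\to v$ from the $q$-th persistence pairing graph; if $w_{uv}=0$, then choosing any nonzero $a$ creates that edge.
   Context: $K$ is a finite CW complex with fixed cell orientations and set of open cells $\mathcal K$; $\Bbbk$ is a field. $C_q$, $\partial_q$, $H_q$ denote cellular chains, boundary and homology with coefficients in $\Bbbk$. A filtration function $f:\mathcal K\to\mathbb R$ is fixed, i.e. $\tau\subseteq\overline\sigma$ implies $f(\tau)\le f(\sigma)$; its values are called filtration values. $K_t$ (resp. $K_{t^-}$) is the union of the cells $\sigma$ with $f(\sigma)\le t$ (resp. $f(\sigma)<t$), and $i_t:K_{t^-}\hookrightarrow K_t$ is the inclusion. The cells are totally ordered $\sigma_1\prec\dots\prec\sigma_N$ so that $f(\sigma_i)<f(\sigma_j)$ implies $i<j$, and $\sigma_i\subseteq\overline{\sigma_j}$, $\sigma_i\ne\sigma_j$ implies $i<j$. The sets $K_t$, $K_{t^-}$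 and $\bigcup_{\ell\le p}\sigma_\ell$ are CW subcomplexes. The boundary matrix $D\in\Bbbk^{N\times N}$ has entries $D_{ij}=[\sigma_j:\sigma_i]$ (cellular incidence coefficients), so its $j$-th column is the coordinate vector of $\partial\sigma_j$. For a nonzero column $c$, $\operatorname{low}(c)=\max\{i\mid c_i\neq 0\}$. A matrix is reduced if no two of its nonzero columns have the same low. Fix a factorization $\mathcal R=(R,V)$, $R=DV$, with $R$ reduced and $V$ upper unitriangular and dimension preserving (column $V_i$ is supported only on cells of the same dimension as $\sigma_i$). Columns are identified with cellular chains. An index $i$ (or cell $\sigma_i$) is positive if $R_i=0$; then $z_i:=V_i$ is its selected birth cycle. A pair $(i,j)$ with $R_j\ne0$ and $\operatorname{low}(R_j)=i$ is a persistence pair. For positive $\sigma_i$, $\operatorname{pair}(i)=j$ if $(i,j)$ is a persistence pair (such $j$ is unique), and $\operatorname{pair}(i)=\infty$ otherwise. $\mathcal V^{(q)}$ is the set of labeled nonzero $q$-th persistence intervals: each $u\in\mathcal V^{(q)}$ corresponds to a positive $q$-cell with index $i(u)$, with $b_u=f(\sigma_{i(u)})$, $d_u=f(\sigma_{\operatorname{pair}(i(u))})$ if $\operatorname{pair}(i(u))<\infty$ and $d_u=\infty$ otherwise, and only those with $b_u<d_u$ are included. The multiset of intervals $[b_u,d_u)$, $u\in\mathcal V^{(q)}$, is the $q$-th barcode. Put $z_u:=z_{i(u)}$. Define $\mathcal D_t^{(q)}=\{u\in\mathcal V^{(q)}\mid b_u<t,\ d_u=t\}$ and $\mathcal S_t^{(q)}=\{v\in\mathcal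 V^{(q)}\mid b_v<t<d_v\}$. $[\cdot]_t$ and $[\cdot]_{t^-}$ denote classes in $H_q(K_t;\Bbbk)$ and $H_q(K_{t^-};\Bbbk)$. The classes $[z_v]_t$, $v\in\mathcal S_t^{(q)}$, form a basis of $\operatorname{im}(i_t)_*$; the transition coefficients are the unique scalars $w_{uv}\in\Bbbk$ ($u\in\mathcal D_t^{(q)}$, $v\in\mathcal S_t^{(q)}$) with $(i_t)_*[z_u]_{t^-}=\sum_{v\in\mathcal S_t^{(q)}}w_{uv}[z_v]_t$. They depend on the chosen $V$. The $q$-th persistence pairing graph of $(K,f,\prec,\Bbbk,\mathcal R)$ is the directed graph with vertex set $\mathcal V^{(q)}$ and edge set $\{(u,v)\mid d_u<\infty,\ b_v<d_u<d_v,\ w_{uv}\ne0\}$; an edge $(u,v)$ is written $u\to v$. *)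

theory Defs
  imports
    "HOL-Homology.Homology"
    "HOL-Library.Extended_Nat"
    "HOL-Library.Extended_Real"
    "HOL-Library.Multiset"
    "Jordan_Normal_Form.Matrix"
    "Jordan_Normal_Form.Column_Operations"
    "Graph_Theory.Pair_Digraph"
begin

section \<open>Finite CW complexes, oriented cells, cellular incidence coefficients\<close>

definition unit_disc :: "nat \<Rightarrow> (nat \<Rightarrow> real) topology" where
  "unit_disc n = subtopology (Euclidean_space n) {x. (\<Sum>l<n. (x l)\<^sup>2) \<le> 1}"

definition disc_interior :: "nat \<Rightarrow> (nat \<Rightarrow> real) set" where
  "disc_interior n = {x \<in> topspace (unit_disc n). (\<Sum>l<n. (x l)\<^sup>2) < 1}"

text \<open>For \<open>n = 0\<close> the disc is a point and the bounding sphere is empty.\<close>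

definition disc_boundary :: "nat \<Rightarrow> (nat \<Rightarrow> real) set" where
  "disc_boundary n = {x \<in> topspace (unit_disc n). (\<Sum>l<n. (x l)\<^sup>2) = 1}"

text \<open>
  The data of a finite filtered CW complex with totally ordered cells. Open cells are point sets of
  the underlying space. An orientation of a cell is a generator of the infinite cyclic group
  \<open>H\<^sub>n(D\<^sup>n, S\<^sup>n\<^sup>-\<^sup>1; \<int>)\<close>, transported by the characteristic map. The cells are listed
  increasingly as \<open>cell_at K 0, \<dots>, cell_at K (N - 1)\<close>, so all indices start at \<open>0\<close>.
\<close>

record 'a filtered_cw =
  total_space :: "'a topology"
  cells :: "'a set set"
  cell_dim :: "'a set \<Rightarrow> nat"
  char_map :: "'a set \<Rightarrow> (nat \<Rightarrow> real) \<Rightarrow> 'a"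
  orientation :: "'a set \<Rightarrow> (nat \<Rightarrow> real) chain set"
  incidence :: "'a set \<Rightarrow> 'a set \<Rightarrow> int"
  filt :: "'a set \<Rightarrow> real"
  cell_at :: "nat \<Rightarrow> 'a set"

definition finite_cw_complex :: "'a filtered_cw \<Rightarrow> bool" where
  "finite_cw_complex K \<longleftrightarrow>
     Hausdorff_space (total_space K) \<and>
     finite (cells K) \<and> pairwise disjnt (cells K) \<and> \<Union>(cells K) = topspace (total_space K) \<and>
     (\<forall>\<sigma>\<in>cells K.
        continuous_map (unit_disc (cell_dim K \<sigma>)) (total_space K) (char_map K \<sigma>) \<and>
        homeomorphic_map
          (subtopology (unit_disc (cell_dim K \<sigma>)) (disc_interior (cell_dim K \<sigma>)))
          (subtopology (total_space K) \<sigma>) (char_map K \<sigma>) \<and>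
        char_map K \<sigma> ` disc_boundary (cell_dim K \<sigma>)
          \<subseteq> \<Union>{\<tau>\<in>cells K. cell_dim K \<tau> < cell_dim K \<sigma>})"

definition oriented_cells :: "'a filtered_cw \<Rightarrow> bool" where
  "oriented_cells K \<longleftrightarrow>
     (\<forall>\<sigma>\<in>cells K.
        let n = cell_dim K \<sigma>;
            G = relative_homology_group (int n) (unit_disc n) (disc_boundary n)
        in orientation K \<sigma> \<in> carrier G \<and> generate G {orientation K \<sigma>} = carrier G)"

definition skeleton :: "'a filtered_cw \<Rightarrow> int \<Rightarrow> 'a set" where
  "skeleton K n = \<Union>{\<sigma>\<in>cells K. int (cell_dim K \<sigma>) \<le> n}"

text \<open>The integral cellular chain group \<open>H\<^sub>n(K\<^sup>n, K\<^sup>n\<^sup>-\<^sup>1; \<int>)\<close>, written multiplicatively.\<close>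

definition cellular_group :: "'a filtered_cw \<Rightarrow> int \<Rightarrow> 'a chain set monoid" where
  "cellular_group K n =
     relative_homology_group n (subtopology (total_space K) (skeleton K n)) (skeleton K (n - 1))"

definition cell_class :: "'a filtered_cw \<Rightarrow> 'a set \<Rightarrow> 'a chain set" where
  "cell_class K \<sigma> =
     (let n = cell_dim K \<sigma> in
      hom_induced (int n) (unit_disc n) (disc_boundary n)
        (subtopology (total_space K) (skeleton K (int n))) (skeleton K (int n - 1))
        (char_map K \<sigma>) (orientation K \<sigma>))"

text \<open>
  The incidence coefficients \<open>[\<sigma>:\<tau>]\<close> are the coordinates of the boundary of the oriented cell
  \<open>\<sigma>\<close> in the basis of \<open>H\<^sub>n\<^sub>-\<^sub>1(K\<^sup>n\<^sup>-\<^sup>1, K\<^sup>n\<^sup>-\<^sup>2; \<int>)\<close> given by the oriented \<open>(n-1)\<close>-cells. The boundary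
  map is the connecting map of the triple \<open>(K\<^sup>n, K\<^sup>n\<^sup>-\<^sup>1, K\<^sup>n\<^sup>-\<^sup>2)\<close>. Since the oriented cells form a
  basis, exactly one function (on pairs of cells) satisfies this predicate.
\<close>

definition incidence_coefficients :: "'a filtered_cw \<Rightarrow> bool" where
  "incidence_coefficients K \<longleftrightarrow>
     (\<forall>\<sigma>\<in>cells K. \<forall>\<tau>\<in>cells K. cell_dim K \<sigma> \<noteq> cell_dim K \<tau> + 1 \<longrightarrow> incidence K \<sigma> \<tau> = 0) \<and>
     (\<forall>\<sigma>\<in>cells K. \<forall>m. cell_dim K \<sigma> = Suc m \<longrightarrow>
        hom_relboundary (int (Suc m)) (subtopology (total_space K) (skeleton K (int (Suc m))))
            (skeleton K (int m)) (skeleton K (int m - 1)) (cell_class K \<sigma>)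
        = (\<Otimes>\<^bsub>cellular_group K (int m)\<^esub>\<tau>\<in>{\<tau>\<in>cells K. cell_dim K \<tau> = m}.
             cell_class K \<tau> [^]\<^bsub>cellular_group K (int m)\<^esub> incidence K \<sigma> \<tau>))"

definition num_cells :: "'a filtered_cw \<Rightarrow> nat" where
  "num_cells K = card (cells K)"

definition filtration_function :: "'a filtered_cw \<Rightarrow> bool" where
  "filtration_function K \<longleftrightarrow>
     (\<forall>\<sigma>\<in>cells K. \<forall>\<tau>\<in>cells K. \<tau> \<subseteq> total_space K closure_of \<sigma> \<longrightarrow> filt K \<tau> \<le> filt K \<sigma>)"

definition compatible_cell_order :: "'a filtered_cw \<Rightarrow> bool" where
  "compatible_cell_order K \<longleftrightarrow>
     bij_betw (cell_at K) {..<num_cells K} (cells K) \<and>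
     (\<forall>i<num_cells K. \<forall>j<num_cells K.
        filt K (cell_at K i) < filt K (cell_at K j) \<longrightarrow> i < j) \<and>
     (\<forall>i<num_cells K. \<forall>j<num_cells K.
        cell_at K i \<subseteq> total_space K closure_of cell_at K j \<longrightarrow> cell_at K i \<noteq> cell_at K j \<longrightarrow> i < j)"

definition filtered_cw_complex :: "'a filtered_cw \<Rightarrow> bool" where
  "filtered_cw_complex K \<longleftrightarrow>
     finite_cw_complex K \<and> oriented_cells K \<and> incidence_coefficients K \<and>
     filtration_function K \<and> compatible_cell_order K"

section \<open>Cellular homology with field coefficients\<close>

text \<open>
  A chain is its coefficient function on the cells, vanishing off the set of cells. A CW subcomplex
  is represented by its set of cells \<open>A\<close>.
\<close>

definition chains :: "'a filtered_cw \<Rightarrow> nat \<Rightarrow> 'a set set \<Rightarrow> ('a set \<Rightarrow> 'k::field) set" where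
  "chains K q A = {c. \<forall>\<sigma>. c \<sigma> \<noteq> 0 \<longrightarrow> \<sigma> \<in> cells K \<and> \<sigma> \<in> A \<and> cell_dim K \<sigma> = q}"

definition cellular_boundary :: "'a filtered_cw \<Rightarrow> ('a set \<Rightarrow> 'k::field) \<Rightarrow> 'a set \<Rightarrow> 'k" where
  "cellular_boundary K c =
     (\<lambda>\<tau>. if \<tau> \<in> cells K then \<Sum>\<sigma>\<in>cells K. c \<sigma> * of_int (incidence K \<sigma> \<tau>) else 0)"

definition cycles :: "'a filtered_cw \<Rightarrow> nat \<Rightarrow> 'a set set \<Rightarrow> ('a set \<Rightarrow> 'k::field) set" where
  "cycles K q A = {z \<in> chains K q A. cellular_boundary K z = (\<lambda>_. 0)}"

definition boundaries :: "'a filtered_cw \<Rightarrow> nat \<Rightarrow> 'a set set \<Rightarrow> ('a set \<Rightarrow> 'k::field) set" where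
  "boundaries K q A = cellular_boundary K ` chains K (q + 1) A"

definition homology_class ::
  "'a filtered_cw \<Rightarrow> nat \<Rightarrow> 'a set set \<Rightarrow> ('a set \<Rightarrow> 'k::field) \<Rightarrow> ('a set \<Rightarrow> 'k) set" where
  "homology_class K q A z = {z' \<in> cycles K q A. (\<lambda>\<sigma>. z' \<sigma> - z \<sigma>) \<in> boundaries K q A}"

text \<open>The map \<open>H\<^sub>q(A) \<rightarrow> H\<^sub>q(B)\<close> induced by an inclusion \<open>A \<subseteq> B\<close> of subcomplexes.\<close>

definition inclusion_map ::
  "'a filtered_cw \<Rightarrow> nat \<Rightarrow> 'a set set \<Rightarrow> ('a set \<Rightarrow> 'k::field) set \<Rightarrow> ('a set \<Rightarrow> 'k) set" where
  "inclusion_map K q B c = (\<Union>z\<in>c. homology_class K q B z)"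

text \<open>The linear combination \<open>\<Sum>v\<in>I. w v * c v\<close> of classes in \<open>H\<^sub>q(A)\<close>, formed on representatives.\<close>

definition class_lincomb ::
  "'a filtered_cw \<Rightarrow> nat \<Rightarrow> 'a set set \<Rightarrow> (nat \<Rightarrow> 'k::field) \<Rightarrow> nat set \<Rightarrow>
   (nat \<Rightarrow> ('a set \<Rightarrow> 'k) set) \<Rightarrow> ('a set \<Rightarrow> 'k) set" where
  "class_lincomb K q A w I c =
     (\<Union>r \<in> {r. \<forall>v\<in>I. r v \<in> c v}. homology_class K q A (\<lambda>\<sigma>. \<Sum>v\<in>I. w v * r v \<sigma>))"

definition sublevel :: "'a filtered_cw \<Rightarrow> real \<Rightarrow> 'a set set" where
  "sublevel K t = {\<sigma>\<in>cells K. filt K \<sigma> \<le> t}"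

definition strict_sublevel :: "'a filtered_cw \<Rightarrow> real \<Rightarrow> 'a set set" where
  "strict_sublevel K t = {\<sigma>\<in>cells K. filt K \<sigma> < t}"

section \<open>Matrix reduction and barcodes\<close>

definition boundary_matrix :: "'a filtered_cw \<Rightarrow> 'k::field mat" where
  "boundary_matrix K =
     mat (num_cells K) (num_cells K)
       (\<lambda>(i, j). of_int (incidence K (cell_at K j) (cell_at K i)))"

definition low :: "'k::field mat \<Rightarrow> nat \<Rightarrow> nat" where
  "low M j = Max {r. r < dim_row M \<and> M $$ (r, j) \<noteq> 0}"

definition reduced :: "'k::field mat \<Rightarrow> bool" where
  "reduced M \<longleftrightarrow>
     (\<forall>j<dim_col M. \<forall>j'<dim_col M.
        col M j \<noteq> 0\<^sub>v (dim_row M) \<longrightarrow> col M j' \<noteq> 0\<^sub>v (dim_row M) \<longrightarrow> j \<noteq> j' \<longrightarrow> low M j \<noteq> low M j')"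

definition reduction :: "'a filtered_cw \<Rightarrow> 'k::field mat \<Rightarrow> 'k mat \<Rightarrow> bool" where
  "reduction K R V \<longleftrightarrow>
     V \<in> carrier_mat (num_cells K) (num_cells K) \<and>
     R = boundary_matrix K * V \<and> reduced R \<and>
     upper_triangular V \<and> (\<forall>j<num_cells K. V $$ (j, j) = 1) \<and>
     (\<forall>r<num_cells K. \<forall>j<num_cells K.
        V $$ (r, j) \<noteq> 0 \<longrightarrow> cell_dim K (cell_at K r) = cell_dim K (cell_at K j))"

definition column_chain :: "'a filtered_cw \<Rightarrow> 'k::field mat \<Rightarrow> nat \<Rightarrow> 'a set \<Rightarrow> 'k" where
  "column_chain K M j =
     (\<lambda>\<sigma>. if \<sigma> \<in> cells K then M $$ (inv_into {..<num_cells K} (cell_at K) \<sigma>, j) else 0)"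

definition positive :: "'a filtered_cw \<Rightarrow> 'k::field mat \<Rightarrow> nat \<Rightarrow> bool" where
  "positive K R i \<longleftrightarrow> i < num_cells K \<and> col R i = 0\<^sub>v (num_cells K)"

definition persistence_pairs :: "'a filtered_cw \<Rightarrow> 'k::field mat \<Rightarrow> (nat \<times> nat) set" where
  "persistence_pairs K R =
     {(i, j). j < num_cells K \<and> col R j \<noteq> 0\<^sub>v (num_cells K) \<and> low R j = i}"

definition pair_index :: "'a filtered_cw \<Rightarrow> 'k::field mat \<Rightarrow> nat \<Rightarrow> enat" where
  "pair_index K R i =
     (if \<exists>j. (i, j) \<in> persistence_pairs K R
      then enat (THE j. (i, j) \<in> persistence_pairs K R) else \<infinity>)"

text \<open>An interval \<open>u\<close> is labeled by its birth index \<open>i(u)\<close>, so labels are indices of positive cells.\<close>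

definition birth :: "'a filtered_cw \<Rightarrow> nat \<Rightarrow> real" where
  "birth K u = filt K (cell_at K u)"

definition death :: "'a filtered_cw \<Rightarrow> 'k::field mat \<Rightarrow> nat \<Rightarrow> ereal" where
  "death K R u = (case pair_index K R u of enat j \<Rightarrow> ereal (filt K (cell_at K j)) | \<infinity> \<Rightarrow> \<infinity>)"

definition intervals :: "'a filtered_cw \<Rightarrow> 'k::field mat \<Rightarrow> nat \<Rightarrow> nat set" where
  "intervals K R q =
     {u. positive K R u \<and> cell_dim K (cell_at K u) = q \<and> ereal (birth K u) < death K R u}"

definition barcode :: "'a filtered_cw \<Rightarrow> 'k::field mat \<Rightarrow> nat \<Rightarrow> real set multiset" where
  "barcode K R q =
     image_mset (\<lambda>u. {x. birth K u \<le> x \<and> ereal x < death K R u}) (mset_set (intervals K R q))"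

section \<open>Transition coefficients and the persistence pairing graph\<close>

definition dying :: "'a filtered_cw \<Rightarrow> 'k::field mat \<Rightarrow> nat \<Rightarrow> real \<Rightarrow> nat set" where
  "dying K R q t = {u \<in> intervals K R q. birth K u < t \<and> death K R u = ereal t}"

definition surviving :: "'a filtered_cw \<Rightarrow> 'k::field mat \<Rightarrow> nat \<Rightarrow> real \<Rightarrow> nat set" where
  "surviving K R q t = {v \<in> intervals K R q. birth K v < t \<and> ereal t < death K R v}"

text \<open>The coefficients are set to zero outside \<open>surviving K R q t\<close> to make the function unique.\<close>

definition transition_coeffs ::
  "'a filtered_cw \<Rightarrow> 'k::field mat \<Rightarrow> 'k mat \<Rightarrow> nat \<Rightarrow> real \<Rightarrow> nat \<Rightarrow> nat \<Rightarrow> 'k" where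
  "transition_coeffs K R V q t u =
     (THE w. (\<forall>v. v \<notin> surviving K R q t \<longrightarrow> w v = 0) \<and>
        inclusion_map K q (sublevel K t)
          (homology_class K q (strict_sublevel K t) (column_chain K V u))
        = class_lincomb K q (sublevel K t) w (surviving K R q t)
            (\<lambda>v. homology_class K q (sublevel K t) (column_chain K V v)))"

definition transition_coeff ::
  "'a filtered_cw \<Rightarrow> 'k::field mat \<Rightarrow> 'k mat \<Rightarrow> nat \<Rightarrow> nat \<Rightarrow> nat \<Rightarrow> 'k" where
  "transition_coeff K R V q u v = transition_coeffs K R V q (real_of_ereal (death K R u)) u v"

definition transition_support ::
  "'a filtered_cw \<Rightarrow> 'k::field mat \<Rightarrow> 'k mat \<Rightarrow> nat \<Rightarrow> (nat \<times> nat) set" where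
  "transition_support K R V q =
     {(u, v). \<exists>t. u \<in> dying K R q t \<and> v \<in> surviving K R q t \<and> transition_coeff K R V q u v \<noteq> 0}"

definition pairing_graph ::
  "'a filtered_cw \<Rightarrow> 'k::field mat \<Rightarrow> 'k mat \<Rightarrow> nat \<Rightarrow> nat pair_pre_digraph" where
  "pairing_graph K R V q =
     \<lparr> pverts = intervals K R q,
       parcs = {(u, v). u \<in> intervals K R q \<and> v \<in> intervals K R q \<and> death K R u < \<infinity> \<and>
                  ereal (birth K v) < death K R u \<and> death K R u < death K R v \<and>
                  transition_coeff K R V q u v \<noteq> 0} \<rparr>"

end

(*
  The cycle z_i of V is replaced by z_i + a z_k, and V' is V times an elementary matrix. As R_i = R_k = 0,
  the product D V' is again R, so everything computed from R is unchanged. At t = d_u the index k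
  survives and i does not, hence the basis cycles z_v are unchanged and the class of z_i is shifted by
  a [z_k]_t: the coefficient w_uv becomes w_uv + a.

  This presupposes that the transition coefficients exist and are unique. Uniqueness: a linear relation
  among the [z_v]_t is a combination of columns of R with indices in K_t; comparing the lowest entries
  pairs the largest v of the relation with a cell of K_t, so v does not survive. Existence: if (u, j) is a
  pair with f(sigma_j) <= t, subtracting the multiple of the boundary R_j that cancels the entry u of z_u
  leaves a cycle on cells before u, a combination of earlier birth cycles, and one proceeds by
  induction on u.

  That R_j is itself a cycle needs D D = 0 for the topologically defined incidence coefficients. The
  connecting maps of the skeleta compose to zero, and the coefficient of an oriented cell sigma of dimension n
  is read off in the local homology H_n(K^n, K^n - p) at the centre p of sigma: it kills the classes of the
  other n-cells, and the class of sigma has infinite order there by excision and H_n(D^n, S^(n-1)) = Z.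
*)

theory Submission
  imports Defs
begin

subsection \<open>Relative homology of the disc\<close>


text \<open>Expresses the disc as a subspace of the type of real sequences, so that compactness and
  continuity can be proved with the type-class topology.\<close>

lemma unit_disc_eq_top_of_set:
  "unit_disc n = top_of_set {x. (\<forall>i\<ge>n. x i = 0) \<and> (\<Sum>l<n. (x l)\<^sup>2) \<le> 1}"
  by (simp add: unit_disc_def Euclidean_space_def euclidean_product_topology subtopology_subtopology Collect_conj_eq Int_commute)

lemma topspace_unit_disc: "topspace (unit_disc n) = {x. (\<forall>i\<ge>n. x i = 0) \<and> (\<Sum>l<n. (x l)\<^sup>2) \<le> 1}"
  by (simp add: unit_disc_eq_top_of_set)

lemma zero_in_disc_interior: "(\<lambda>_. 0) \<in> disc_interior n"
  by (simp add: disc_interior_def topspace_unit_disc)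

lemma disc_boundary_eq: "disc_boundary n = topspace (unit_disc n) - disc_interior n"
  by (auto simp: disc_boundary_def disc_interior_def topspace_unit_disc)

lemma continuous_on_sum_squares: "continuous_on S (\<lambda>x::nat\<Rightarrow>real. \<Sum>l<n. (x l)\<^sup>2)"
  by (intro continuous_intros continuous_on_subset [OF continuous_on_product_coordinates]) auto

lemma continuous_on_snd_coordinate: "continuous_on S (\<lambda>z::'a::topological_space \<times> (nat \<Rightarrow> real). snd z i)"
  by (rule continuous_on_product_then_coordinatewise) (intro continuous_intros)

text \<open>The disc is closed and lies in a product of copies of \<open>{-1..1}\<close>, which is
  compact by Tychonoff. Compactness later makes closed cells closed subsets.\<close>

lemma compact_space_unit_disc: "compact_space (unit_disc n)"
proof -
  let ?D = "{x. (\<forall>i\<ge>n. x i = 0) \<and> (\<Sum>l<n. (x l)\<^sup>2) \<le> (1::real)}"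
  have D: "?D = (\<Inter>i\<in>{n..}. {x. x i = 0}) \<inter> {x. (\<Sum>l<n. (x l)\<^sup>2) \<le> 1}"
    by auto
  have "closed ?D"
    unfolding D
    by (intro closed_Int closed_INT ballI closed_Collect_eq closed_Collect_le continuous_on_sum_squares
              continuous_on_product_coordinates continuous_on_const)
  moreover have "compactin (powertop_real UNIV) (PiE UNIV (\<lambda>i::nat. {-1..1}))"
    by (subst compactin_PiE) simp
  then have "compact (PiE UNIV (\<lambda>i::nat. {-1..1::real}))"
    by (simp add: euclidean_product_topology)
  moreover have "?D \<subseteq> PiE UNIV (\<lambda>i::nat. {-1..1})"
  proof
    fix x :: "nat \<Rightarrow> real" assume x: "x \<in> ?D"
    have "(x i)\<^sup>2 \<le> 1" for i
    proof (cases "i < n")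
      case True
      then have "(x i)\<^sup>2 \<le> (\<Sum>l<n. (x l)\<^sup>2)"
        by (intro member_le_sum) auto
      then show ?thesis using x by simp
    qed (use x in auto)
    then have "-1 \<le> x i \<and> x i \<le> 1" for i
      using abs_square_le_1 [of "x i"] by (simp add: abs_le_iff)
    then show "x \<in> PiE UNIV (\<lambda>i::nat. {-1..1})"
      by auto
  qed
  then have "?D = PiE UNIV (\<lambda>i::nat. {-1..1}) \<inter> ?D"
    by blast
  ultimately have "compact ?D"
    by (metis (no_types, lifting) compact_Int_closed)
  then show ?thesis
    by (simp add: unit_disc_eq_top_of_set compact_space_subtopology)
qed

text \<open>Shrink radially: at time \<open>t\<close> a point is scaled by \<open>1 - t\<close>,
  which does not increase its norm.\<close>

lemma contractible_space_unit_disc: "contractible_space (unit_disc n)"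
proof -
  let ?D = "{x. (\<forall>i\<ge>n. x i = 0) \<and> (\<Sum>l<n. (x l)\<^sup>2) \<le> (1::real)}"
  have "homotopic_with (\<lambda>x. True) (unit_disc n) (unit_disc n) id (\<lambda>x. \<lambda>_. 0)"
    unfolding homotopic_with_def
  proof (intro exI conjI ballI)
    let ?h = "\<lambda>(t, x) i. (1 - t) * x i :: real"
    have "continuous_on ({0..1} \<times> ?D) ?h"
      unfolding split_def
      by (intro continuous_on_coordinatewise_then_product continuous_intros continuous_on_snd_coordinate)
    moreover have "?h ` ({0..1} \<times> ?D) \<subseteq> ?D"
    proof clarsimp
      fix t :: real and x :: "nat \<Rightarrow> real"
      assume t: "0 \<le> t" "t \<le> 1" and x: "(\<Sum>l<n. (x l)\<^sup>2) \<le> 1"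
      have "(\<Sum>l<n. ((1 - t) * x l)\<^sup>2) = (1 - t)\<^sup>2 * (\<Sum>l<n. (x l)\<^sup>2)"
        by (simp add: power_mult_distrib sum_distrib_left)
      also have "\<dots> \<le> 1 * 1"
        using t x by (intro mult_mono) (auto simp: sum_nonneg power_le_one)
      finally show "(\<Sum>l<n. ((1 - t) * x l)\<^sup>2) \<le> 1" by simp
    qed
    ultimately show "continuous_map (prod_topology (top_of_set {0..1}) (unit_disc n)) (unit_disc n) ?h"
      by (simp add: unit_disc_eq_top_of_set image_subset_iff_funcset)
  qed auto
  then show ?thesis
    unfolding contractible_space_def by blast
qed

lemma openin_disc_interior: "openin (unit_disc n) (disc_interior n)"
proof -
  have "open {x::nat\<Rightarrow>real. (\<Sum>l<n. (x l)\<^sup>2) < 1}"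
    by (intro open_Collect_less continuous_on_sum_squares continuous_on_const)
  then show ?thesis
    unfolding unit_disc_eq_top_of_set disc_interior_def topspace_unit_disc
    by (auto simp: openin_open Collect_conj_eq)
qed

section \<open>Homology of the disc relative to its sphere and to the punctured disc\<close>

lemma disc_boundary_subset_Diff: "disc_boundary n \<subseteq> topspace (unit_disc n) - {\<lambda>_. 0}"
  using zero_in_disc_interior by (auto simp: disc_boundary_eq)

text \<open>Links the boundary to the standard sphere, whose homology is known. The shift of index
  reflects that the boundary of the 0-disc is empty and has to be treated separately.\<close>

lemma subtopology_unit_disc_Suc: "subtopology (unit_disc (Suc m)) (disc_boundary (Suc m)) = nsphere m"
  unfolding unit_disc_eq_top_of_set nsphere disc_boundary_def euclidean_product_topology topspace_unit_disc
   subtopology_subtopology lessThan_Suc_atMost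
  by (rule arg_cong [where f="subtopology _"]) (auto simp: Suc_le_eq)

text \<open>For positive \<open>n\<close> the disc is contractible, so the connecting map identifies
  the group with the reduced homology of the sphere one degree lower. For \<open>n = 0\<close> the
  pair is a point relative to the empty set, and the group is the coefficient group.\<close>

lemma isomorphic_relative_homology_disc:
  "relative_homology_group (int n) (unit_disc n) (disc_boundary n) \<cong> integer_group"
proof (cases n)
  case 0
  have "disc_boundary 0 = {}" "topspace (unit_disc 0) = {\<lambda>_. 0}"
    by (auto simp: disc_boundary_def topspace_unit_disc)
  then show ?thesis using homology_coefficients 0 by auto
next
  case (Suc m)
  have ne: "topspace (unit_disc n) \<inter> disc_boundary n \<noteq> {}"
    using nonempty_nsphere [of m] subtopology_unit_disc_Suc [of m] Suc 
    by (metis null_topspace_iff_trivial topspace_subtopology)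
  have "relative_homology_group (int n) (unit_disc n) (disc_boundary n)
        \<cong> reduced_homology_group (int m) (nsphere m)"
    using isomorphic_group_relative_homology_of_contractible [OF contractible_space_unit_disc ne, of "int n"]
      subtopology_unit_disc_Suc [of m] Suc by simp
  also have "\<dots> \<cong> integer_group"
    by (rule reduced_homology_group_nsphere)
  finally show ?thesis .
qed

text \<open>A nonzero exponent would give the generator finite order and make the whole group
  finite, unlike the integers. This is what lets integer coefficients be recovered from powers of an
  orientation.\<close>

lemma int_pow_generator_eq_one:
  assumes G: "group G" and iso: "G \<cong> integer_group"
    and g: "g \<in> carrier G" "generate G {g} = carrier G" and k: "g [^]\<^bsub>G\<^esub> (k::int) = \<one>\<^bsub>G\<^esub>"
  shows "k = 0"
proof (rule ccontr)
  assume "k \<noteq> 0"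
  interpret group G by fact
  have "infinite (carrier G)"
    using iso unfolding is_iso_def iso_def
    by (metis (mono_tags, lifting) bij_betw_finite carrier_integer_group ex_in_conv infinite_UNIV_int mem_Collect_eq)
  moreover have "finite (carrier (subgroup_generated G {g}))"
    using \<open>k \<noteq> 0\<close> k finite_cyclic_subgroup_int [OF g(1)] by blast
  then have "finite (carrier G)"
    using g by (simp add: subgroup_generated_def)
  ultimately show False by blast
qed

text \<open>Radial projection deforms the punctured disc onto its boundary sphere while fixing the
  sphere pointwise.\<close>

lemma trivial_relative_homology_punctured_disc:
  "trivial_group (relative_homology_group p
     (subtopology (unit_disc n) (topspace (unit_disc n) - {\<lambda>_. 0})) (disc_boundary n))"
proof -
  define P where "P = {x::nat\<Rightarrow>real. (\<forall>i\<ge>n. x i = 0) \<and> (\<Sum>l<n. (x l)\<^sup>2) \<le> 1 \<and> x \<noteq> (\<lambda>_. 0)}"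
  define N where "N = (\<lambda>x::nat\<Rightarrow>real. sqrt (\<Sum>l<n. (x l)\<^sup>2))"
  \<comment> \<open>The path runs along the ray through \<open>x\<close>: the norm at time
    \<open>t\<close> is \<open>(1 - t) + t * N x\<close>. Thus time 0 is the radial projection and
    time 1 the identity.\<close>
  define h where "h = (\<lambda>(t::real, x) i. ((1 - t) / N x + t) * x i)"
  define X where "X = subtopology (unit_disc n) (topspace (unit_disc n) - {\<lambda>_. 0})"
  have X: "X = top_of_set P"
    unfolding X_def unit_disc_eq_top_of_set P_def
    by (auto simp: subtopology_subtopology intro!: arg_cong [where f="subtopology _"])
  have bd: "disc_boundary n \<subseteq> P"
    using disc_boundary_subset_Diff [of n] by (auto simp: P_def topspace_unit_disc)
  have N: "0 < N x" "N x \<le> 1" "(N x)\<^sup>2 = (\<Sum>l<n. (x l)\<^sup>2)" if "x \<in> P" for x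
  proof -
    have "\<exists>i. x i \<noteq> 0" "\<And>i. n \<le> i \<Longrightarrow> x i = 0"
      using that by (auto simp: P_def)
    then obtain i where i: "x i \<noteq> 0" "i < n"
      by (meson not_le)
    then have "0 < (x i)\<^sup>2" "(x i)\<^sup>2 \<le> (\<Sum>l<n. (x l)\<^sup>2)"
      by (auto intro: member_le_sum [where f="\<lambda>l. (x l)\<^sup>2"])
    then have "0 < (\<Sum>l<n. (x l)\<^sup>2)"
      by linarith
    then show "0 < N x" "N x \<le> 1" "(N x)\<^sup>2 = (\<Sum>l<n. (x l)\<^sup>2)"
      using that unfolding N_def P_def by force+
  qed
  have sumh: "(\<Sum>l<n. (h (t, x) l)\<^sup>2) = ((1 - t) + t * N x)\<^sup>2" if "x \<in> P" for t x
  proof -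
    have "(\<Sum>l<n. (h (t, x) l)\<^sup>2) = ((1 - t) / N x + t)\<^sup>2 * (N x)\<^sup>2"
      by (simp add: h_def power_mult_distrib sum_distrib_left N(3) [OF that])
    also have "\<dots> = ((1 - t) + t * N x)\<^sup>2"
      using N(1) [OF that] by (simp add: distrib_right flip: power_mult_distrib)
    finally show ?thesis .
  qed
  have h_in: "h (t, x) \<in> P" if "0 \<le> t" "t \<le> 1" and x: "x \<in> P" for t x
  proof -
    have pos: "0 < (1 - t) / N x + t"
      using that N(1) [OF x] by (cases "t = 0") (auto intro: add_nonneg_pos)
    have "1 - t + t * N x \<le> 1" "0 \<le> 1 - t + t * N x"
      using that N [OF x] by (auto simp: mult_left_le)
    then have le: "(\<Sum>l<n. (h (t, x) l)\<^sup>2) \<le> 1"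
      by (simp add: sumh [OF x] power_le_one)
    obtain i where "x i \<noteq> 0"
      using x unfolding P_def by blast
    then have "h (t, x) i \<noteq> 0"
      using pos by (simp add: h_def)
    then have "h (t, x) \<noteq> (\<lambda>_. 0)"
      by (metis (full_types))
    with le show ?thesis
      using x unfolding P_def by (simp add: h_def)
  qed
  have cont_h: "continuous_on ({0..1} \<times> P) h"
  proof (rule continuous_on_coordinatewise_then_product)
    fix i
    have "continuous_on ({0..1} \<times> P) (\<lambda>z. N (snd z))"
      unfolding N_def
      by (intro continuous_intros continuous_on_snd_coordinate)
    moreover have "\<forall>z\<in>{0..1} \<times> P. N (snd z) \<noteq> 0"
      using N(1) by force
    ultimately show "continuous_on ({0..1} \<times> P) (\<lambda>z. h z i)"
      unfolding h_def split_def
      by (intro continuous_intros continuous_on_snd_coordinate)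
  qed
  have im_h: "h ` ({0..1} \<times> P) \<subseteq> P"
    using h_in by auto
  let ?f = "\<lambda>x. h (0, x)"
  have f_id: "?f x = x" if "x \<in> disc_boundary n" for x
    using that by (simp add: h_def N_def disc_boundary_def)
  have cont_f: "continuous_on P ?f"
    by (rule continuous_on_compose2 [OF cont_h]) (intro continuous_intros, auto)
  have f_bd: "?f x \<in> disc_boundary n" if "x \<in> P" for x
    using h_in [of 0 x] sumh [of x 0] that by (simp add: disc_boundary_def topspace_unit_disc P_def)
  show ?thesis
    unfolding X_def [symmetric]
  proof (rule trivial_relative_homology_group_gen)
    show "continuous_map X (subtopology X (disc_boundary n)) ?f"
      using cont_f f_bd bd by (auto simp: X subtopology_subtopology)
    then have cont: "continuous_map (subtopology X (disc_boundary n)) (subtopology X (disc_boundary n)) ?f"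
      by (rule continuous_map_from_subtopology)
    show "homotopic_with (\<lambda>h. True) (subtopology X (disc_boundary n)) (subtopology X (disc_boundary n)) ?f id"
      by (rule homotopic_with_equal [OF _ _ cont]) (auto simp: f_id)
    show "homotopic_with (\<lambda>k. True) X X ?f id"
      unfolding homotopic_with_def
    proof (intro exI [where x=h] conjI ballI allI)
      show "continuous_map (prod_topology (top_of_set {0..1}) X) X h"
        using cont_h im_h by (simp add: X image_subset_iff_funcset)
    qed (simp_all add: h_def)
  qed
qed

text \<open>Exactness for the triple of disc, punctured disc and sphere: the kernel of the map is
  the image of the homology of the punctured disc relative to the sphere, which is trivial.\<close>

lemma hom_induced_disc_puncture_eq_one:
  assumes a: "a \<in> carrier (relative_homology_group p (unit_disc n) (disc_boundary n))"
    and eq: "hom_induced p (unit_disc n) (disc_boundary n) (unit_disc n) (topspace (unit_disc n) - {\<lambda>_. 0}) id a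
             = \<one>\<^bsub>relative_homology_group p (unit_disc n) (topspace (unit_disc n) - {\<lambda>_. 0})\<^esub>"
  shows "a = \<one>\<^bsub>relative_homology_group p (unit_disc n) (disc_boundary n)\<^esub>"
proof -
  let ?P = "topspace (unit_disc n) - {\<lambda>_. 0}"
  let ?A = "relative_homology_group p (subtopology (unit_disc n) ?P) (disc_boundary n)"
  let ?i = "hom_induced p (subtopology (unit_disc n) ?P) (disc_boundary n) (unit_disc n) (disc_boundary n) id"
  have "a \<in> kernel (relative_homology_group p (unit_disc n) (disc_boundary n))
              (relative_homology_group p (unit_disc n) ?P)
              (hom_induced p (unit_disc n) (disc_boundary n) (unit_disc n) ?P id)"
    using assms by (simp add: kernel_def)
  also have "\<dots> = ?i ` carrier ?A"
    using homology_exactness_triple_3 [OF disc_boundary_subset_Diff [of n], where X="unit_disc n" and p=p] by simp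
  also have "\<dots> = ?i ` {\<one>\<^bsub>?A\<^esub>}"
    using trivial_relative_homology_punctured_disc [of p n] by (simp add: trivial_group_def)
  finally show ?thesis
    using hom_one [OF hom_induced_hom group_relative_homology_group group_relative_homology_group] by simp
qed



section \<open>Injectivity of a characteristic map into local homology\<close>

lemma iso_eq_oneD:
  assumes "f \<in> iso G H" "group G" "group H" "x \<in> carrier G" "f x = \<one>\<^bsub>H\<^esub>"
  shows "x = \<one>\<^bsub>G\<^esub>"
proof -
  have "f \<in> hom G H" "inj_on f (carrier G)"
    using assms(1) by (auto simp: iso_def bij_betw_def)
  then show ?thesis
    using assms hom_one [of f G H] by (metis group.is_monoid inj_onD monoid.one_closed)
qed

lemma closedin_disc_boundary: "closedin (unit_disc n) (disc_boundary n)"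
  by (simp add: closedin_def disc_boundary_eq double_diff openin_disc_interior openin_subset)

text \<open>The map factors through the disc relative to the punctured disc, and the first factor is
  injective by the previous lemma. For the second, excision on both sides replaces the pairs by the
  open disc and the open cell with their centres removed, and between these \<open>\<psi>\<close> is
  a homeomorphism.\<close>

lemma hom_induced_char_map_eq_one:
  assumes cont: "continuous_map (unit_disc n) X \<psi>"
    and hom: "homeomorphic_map (subtopology (unit_disc n) (disc_interior n)) (subtopology X E) \<psi>"
    and E: "openin X E" and cl: "closedin X {\<psi> (\<lambda>_. 0)}" and bd: "\<psi> ` disc_boundary n \<inter> E = {}"
    and a: "a \<in> carrier (relative_homology_group p (unit_disc n) (disc_boundary n))"
    and eq: "hom_induced p (unit_disc n) (disc_boundary n) X (topspace X - {\<psi> (\<lambda>_. 0)}) \<psi> a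
             = \<one>\<^bsub>relative_homology_group p X (topspace X - {\<psi> (\<lambda>_. 0)})\<^esub>"
  shows "a = \<one>\<^bsub>relative_homology_group p (unit_disc n) (disc_boundary n)\<^esub>"
proof -
  define D where "D = unit_disc n"
  define S where "S = disc_boundary n"
  define B where "B = disc_interior n"
  define P where "P = topspace D - {\<lambda>_. 0}"
  define Q where "Q = topspace X - {\<psi> (\<lambda>_. 0)}"
  have BD: "B \<subseteq> topspace D" "S = topspace D - B" "(\<lambda>_. 0) \<in> B"
    using zero_in_disc_interior [of n] by (auto simp: B_def D_def S_def disc_interior_def disc_boundary_eq)
  have EX: "E \<subseteq> topspace X" using E by (rule openin_subset)
  have \<psi>B: "\<psi> ` B = E" "inj_on \<psi> B"
    using homeomorphic_imp_surjective_map [OF hom] homeomorphic_imp_injective_map [OF hom] BD EX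
    by (simp_all add: B_def D_def Int_absorb1)
  have \<psi>S: "\<psi> x \<notin> E" if "x \<in> S" for x
    using bd that unfolding S_def by blast
  \<comment> \<open>Only the centre is sent to the centre: \<open>\<psi>\<close> is injective on the
    open disc and sends the sphere off \<open>E\<close>.\<close>
  have \<psi>P: "\<psi> \<in> P \<rightarrow> Q"
  proof
    fix x assume x: "x \<in> P"
    then have "\<psi> x \<in> topspace X"
      using cont unfolding P_def D_def by (auto simp: continuous_map_def)
    moreover have "\<psi> x \<noteq> \<psi> (\<lambda>_. 0)"
    proof (cases "x \<in> B")
      case True
      then show ?thesis using \<psi>B(2) BD(3) x by (auto simp: inj_on_def P_def)
    next
      case False
      then have "x \<in> S" using x BD by (auto simp: P_def)
      then show ?thesis using \<psi>S \<psi>B(1) BD(3) by blast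
    qed
    ultimately show "\<psi> x \<in> Q" by (simp add: Q_def)
  qed
  have SP: "S \<subseteq> P"
    using BD by (auto simp: P_def)
  define a' where "a' = hom_induced p D S D P id a"
  have a'1: "hom_induced p D P X Q \<psi> a' = \<one>\<^bsub>relative_homology_group p X Q\<^esub>"
  proof -
    have "hom_induced p D P X Q \<psi> a' = hom_induced p D S X Q (\<psi> \<circ> id) a"
      unfolding a'_def by (rule hom_induced_compose') (use SP \<psi>P cont in \<open>auto simp: D_def\<close>)
    then show ?thesis
      using eq by (simp add: D_def S_def Q_def)
  qed
  \<comment> \<open>Excision of the closed sphere \<open>S\<close>, which lies in the open set
    \<open>P\<close>.\<close>
  have iso1: "hom_induced p (subtopology D B) (P - S) D P id
              \<in> iso (relative_homology_group p (subtopology D B) (P - S)) (relative_homology_group p D P)"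
  proof -
    have "Hausdorff_space D"
      unfolding D_def unit_disc_def by (simp add: Hausdorff_Euclidean_space Hausdorff_space_subtopology)
    then have "closedin D {\<lambda>_. 0}"
      using BD by (meson closedin_Hausdorff_singleton subsetD)
    then have "openin D P"
      unfolding P_def by blast
    then have "D closure_of S \<subseteq> D interior_of P"
      using closedin_disc_boundary SP by (simp add: closure_of_closedin interior_of_openin D_def S_def)
    then have "hom_induced p (subtopology D (topspace D - S)) (P - S) (subtopology D (topspace D)) P id
              \<in> iso (relative_homology_group p (subtopology D (topspace D - S)) (P - S))
                    (relative_homology_group p (subtopology D (topspace D)) P)"
      by (rule homology_excision_axiom) (simp add: P_def)
    moreover have "topspace D - S = B" using BD by blast
    ultimately show ?thesis by simp
  qed
  \<comment> \<open>Excision of the complement of \<open>E\<close>; it is closed because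
    \<open>E\<close> is open, and it misses the centre.\<close>
  have iso2: "hom_induced p (subtopology X E) (E - {\<psi> (\<lambda>_. 0)}) X Q id
              \<in> iso (relative_homology_group p (subtopology X E) (E - {\<psi> (\<lambda>_. 0)})) (relative_homology_group p X Q)"
  proof -
    let ?U = "topspace X - E"
    have "openin X Q"
      unfolding Q_def using cl by blast
    moreover have "closedin X ?U"
      using E by blast
    moreover have "?U \<subseteq> Q"
      using \<psi>B BD by (auto simp: Q_def)
    ultimately have "X closure_of ?U \<subseteq> X interior_of Q"
      by (simp add: closure_of_closedin interior_of_openin)
    then have "hom_induced p (subtopology X (topspace X - ?U)) (Q - ?U) (subtopology X (topspace X)) Q id
              \<in> iso (relative_homology_group p (subtopology X (topspace X - ?U)) (Q - ?U))
                    (relative_homology_group p (subtopology X (topspace X)) Q)"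
      by (rule homology_excision_axiom) (simp add: Q_def)
    moreover have "topspace X - ?U = E" "Q - ?U = E - {\<psi> (\<lambda>_. 0)}"
      using EX by (auto simp: Q_def)
    ultimately show ?thesis by simp
  qed
  have PS: "P - S = B - {\<lambda>_. 0}"
    using BD by (auto simp: P_def)
  have \<psi>PS: "\<psi> ` (P - S) = E - {\<psi> (\<lambda>_. 0)}"
    using \<psi>B BD unfolding PS by (auto simp: inj_on_def)
  have iso3: "hom_induced p (subtopology D B) (P - S) (subtopology X E) (E - {\<psi> (\<lambda>_. 0)}) \<psi>
              \<in> iso (relative_homology_group p (subtopology D B) (P - S))
                    (relative_homology_group p (subtopology X E) (E - {\<psi> (\<lambda>_. 0)}))"
    unfolding B_def D_def
  proof (rule homeomorphic_map_relative_homology_iso [OF hom _ \<psi>PS])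
    show "P - S \<subseteq> topspace (subtopology (unit_disc n) (disc_interior n))"
      using BD by (auto simp: P_def B_def D_def)
  qed
  have "a' \<in> carrier (relative_homology_group p D P)"
    unfolding a'_def by (rule hom_induced_carrier)
  then have "a' \<in> hom_induced p (subtopology D B) (P - S) D P id ` carrier (relative_homology_group p (subtopology D B) (P - S))"
    using iso1 by (simp add: iso_def bij_betw_def)
  then obtain b where b: "b \<in> carrier (relative_homology_group p (subtopology D B) (P - S))"
    and a'b: "hom_induced p (subtopology D B) (P - S) D P id b = a'"
    by blast
  have cont_B: "continuous_map (subtopology D B) X \<psi>" "continuous_map (subtopology D B) (subtopology X E) \<psi>"
    using cont homeomorphic_imp_continuous_map [OF hom] by (auto simp: D_def B_def continuous_map_from_subtopology)
  \<comment> \<open>The two ways from the open disc to \<open>X\<close>, through \<open>E\<close>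
    and through the whole disc, agree. The second one kills \<open>b\<close>, and the maps of the
    first are injective.\<close>
  have "hom_induced p (subtopology X E) (E - {\<psi> (\<lambda>_. 0)}) X Q id
          (hom_induced p (subtopology D B) (P - S) (subtopology X E) (E - {\<psi> (\<lambda>_. 0)}) \<psi> b)
        = hom_induced p (subtopology D B) (P - S) X Q (id \<circ> \<psi>) b"
    by (rule hom_induced_compose') (use cont_B \<psi>PS EX in \<open>auto simp: Q_def\<close>)
  also have "\<dots> = hom_induced p (subtopology D B) (P - S) X Q (\<psi> \<circ> id) b"
    by simp
  also have "\<dots> = hom_induced p D P X Q \<psi> (hom_induced p (subtopology D B) (P - S) D P id b)"
    by (rule hom_induced_compose' [symmetric]) (use cont \<psi>P in \<open>auto simp: D_def\<close>)
  also have "\<dots> = \<one>\<^bsub>relative_homology_group p X Q\<^esub>"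
    by (simp add: a'b a'1)
  finally have "hom_induced p (subtopology D B) (P - S) (subtopology X E) (E - {\<psi> (\<lambda>_. 0)}) \<psi> b
                = \<one>\<^bsub>relative_homology_group p (subtopology X E) (E - {\<psi> (\<lambda>_. 0)})\<^esub>"
    by (intro iso_eq_oneD [OF iso2]) (auto simp: hom_induced_carrier)
  then have "b = \<one>\<^bsub>relative_homology_group p (subtopology D B) (P - S)\<^esub>"
    by (intro iso_eq_oneD [OF iso3]) (auto simp: b)
  then have "a' = \<one>\<^bsub>relative_homology_group p D P\<^esub>"
    using a'b hom_one [OF hom_induced_hom group_relative_homology_group group_relative_homology_group] by blast
  then show ?thesis
    using hom_induced_disc_puncture_eq_one [OF a] by (simp add: a'_def D_def S_def P_def)
qed

section \<open>Finite products of integer powers in commutative groups\<close>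

lemma int_pow_sum_finprod:
  assumes "comm_group G" "g \<in> carrier G" "finite A"
  shows "(\<Otimes>\<^bsub>G\<^esub>x\<in>A. g [^]\<^bsub>G\<^esub> (f x :: int)) = g [^]\<^bsub>G\<^esub> (\<Sum>x\<in>A. f x)"
proof -
  interpret comm_group G by fact
  show ?thesis
    using \<open>finite A\<close> by induction (use assms(2) in \<open>auto simp: finprod_insert int_pow_mult\<close>)
qed

lemma hom_finprod_int_pow:
  assumes "comm_group G" "comm_group H" "\<phi> \<in> hom G H" "finite A" "f \<in> A \<rightarrow> carrier G"
  shows "\<phi> (\<Otimes>\<^bsub>G\<^esub>x\<in>A. f x [^]\<^bsub>G\<^esub> (k x :: int)) = (\<Otimes>\<^bsub>H\<^esub>x\<in>A. \<phi> (f x) [^]\<^bsub>H\<^esub> k x)"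
proof -
  interpret G: comm_group G by fact
  interpret H: comm_group H by fact
  interpret group_hom G H \<phi>
    by unfold_locales fact
  show ?thesis
    using assms(4,5)
  proof induction
    case empty
    show ?case by simp
  next
    case (insert x A)
    then show ?case
      by (subst G.finprod_insert H.finprod_insert; force simp: Pi_iff hom_int_pow)+
  qed
qed

subsection \<open>The cellular boundary squares to zero\<close>

text \<open>The composite contains two consecutive maps of the long exact sequence of the pair
  \<open>(Y, T)\<close>: a class coming from the absolute homology of \<open>Y\<close> has trivial
  boundary in \<open>T\<close>.\<close>

lemma hom_relboundary_hom_relboundary:
  assumes "Y = subtopology X S" "q = p + 1"
  shows "hom_relboundary p Y T Z (hom_relboundary q X S T c)
         = \<one>\<^bsub>relative_homology_group (p - 1) (subtopology Y T) Z\<^esub>"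
proof -
  let ?b = "hom_boundary (p+1) X S c"
  have b: "?b \<in> carrier (homology_group p Y)"
    using hom_boundary_carrier [of "p+1" X S c] assms by simp
  have "hom_induced p Y {} Y T id ` carrier (homology_group p Y) =
        kernel (relative_homology_group p Y T) (homology_group (p-1) (subtopology Y T)) (hom_boundary p Y T)"
    using homology_exactness_axiom_1 [of p Y T] by simp
  then have "hom_boundary p Y T (hom_induced p Y {} Y T id ?b) = \<one>\<^bsub>homology_group (p-1) (subtopology Y T)\<^esub>"
    using b by (auto simp: kernel_def)
  then show ?thesis
    using hom_one [OF hom_induced_hom group_relative_homology_group group_relative_homology_group] assms
    by (simp add: hom_relboundary_def)
qed


section \<open>Cells and skeleta of a finite CW complex\<close>

context
  fixes K :: "'a filtered_cw"
  assumes cw: "finite_cw_complex K"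
begin

lemma cell_subset_topspace: "\<sigma> \<in> cells K \<Longrightarrow> \<sigma> \<subseteq> topspace (total_space K)"
  using cw by (auto simp: finite_cw_complex_def)

lemma skeleton_subset_topspace: "skeleton K n \<subseteq> topspace (total_space K)"
  using cell_subset_topspace by (auto simp: skeleton_def)

lemma skeleton_mono: "m \<le> n \<Longrightarrow> skeleton K m \<subseteq> skeleton K n"
  by (fastforce simp: skeleton_def)

lemma char_map_interior: "\<sigma> \<in> cells K \<Longrightarrow> char_map K \<sigma> ` disc_interior (cell_dim K \<sigma>) = \<sigma>"
  using cw cell_subset_topspace [of \<sigma>] homeomorphic_imp_surjective_map
  unfolding finite_cw_complex_def
  by (metis (no_types, lifting) disc_interior_def mem_Collect_eq subsetI topspace_subtopology_subset)

lemma char_map_boundary: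
  assumes "\<sigma> \<in> cells K"
  shows "char_map K \<sigma> ` disc_boundary (cell_dim K \<sigma>) \<subseteq> skeleton K (int (cell_dim K \<sigma>) - 1)"
proof -
  have "char_map K \<sigma> ` disc_boundary (cell_dim K \<sigma>) \<subseteq> \<Union>{\<tau>\<in>cells K. cell_dim K \<tau> < cell_dim K \<sigma>}"
    using cw assms by (auto simp: finite_cw_complex_def)
  also have "\<dots> \<subseteq> skeleton K (int (cell_dim K \<sigma>) - 1)"
    by (fastforce simp: skeleton_def)
  finally show ?thesis .
qed

lemma char_map_image:
  assumes "\<sigma> \<in> cells K"
  shows "char_map K \<sigma> ` topspace (unit_disc (cell_dim K \<sigma>)) \<subseteq> \<sigma> \<union> skeleton K (int (cell_dim K \<sigma>) - 1)"
proof -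
  let ?n = "cell_dim K \<sigma>"
  have "topspace (unit_disc ?n) = disc_interior ?n \<union> disc_boundary ?n"
    by (auto simp: disc_boundary_eq disc_interior_def)
  then show ?thesis
    using char_map_interior [OF assms] char_map_boundary [OF assms] by (auto simp: image_Un)
qed

lemma cell_subset_skeleton: "\<sigma> \<in> cells K \<Longrightarrow> int (cell_dim K \<sigma>) \<le> m \<Longrightarrow> \<sigma> \<subseteq> skeleton K m"
  by (auto simp: skeleton_def)

lemma disjnt_cells: "\<sigma> \<in> cells K \<Longrightarrow> \<tau> \<in> cells K \<Longrightarrow> \<sigma> \<noteq> \<tau> \<Longrightarrow> disjnt \<sigma> \<tau>"
  using cw by (auto simp: finite_cw_complex_def pairwise_def)

lemma disjnt_cell_skeleton:
  assumes "\<sigma> \<in> cells K" "m < int (cell_dim K \<sigma>)"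
  shows "disjnt \<sigma> (skeleton K m)"
  unfolding skeleton_def disjnt_Union2
proof clarify
  fix \<tau> assume "\<tau> \<in> cells K" "int (cell_dim K \<tau>) \<le> m"
  then show "disjnt \<sigma> \<tau>"
    using assms by (intro disjnt_cells) auto
qed

lemma continuous_map_char_map:
  assumes "\<sigma> \<in> cells K" "int (cell_dim K \<sigma>) \<le> m"
  shows "continuous_map (unit_disc (cell_dim K \<sigma>)) (subtopology (total_space K) (skeleton K m)) (char_map K \<sigma>)"
proof -
  have "char_map K \<sigma> ` topspace (unit_disc (cell_dim K \<sigma>)) \<subseteq> skeleton K m"
    using char_map_image [OF assms(1)] cell_subset_skeleton [OF assms]
      skeleton_mono [of "int (cell_dim K \<sigma>) - 1" m] assms(2) by fastforce
  then show ?thesis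
    using cw assms(1) by (auto simp: finite_cw_complex_def continuous_map_in_subtopology)
qed

text \<open>The rest of the skeleton is a finite union of characteristic images of the other discs.
  Each image is compact, hence closed in the Hausdorff skeleton. Openness of the cell is what the
  excision argument requires.\<close>

lemma openin_skeleton_cell:
  assumes "\<sigma> \<in> cells K"
  shows "openin (subtopology (total_space K) (skeleton K (int (cell_dim K \<sigma>)))) \<sigma>"
proof -
  let ?n = "int (cell_dim K \<sigma>)"
  let ?X = "subtopology (total_space K) (skeleton K ?n)"
  let ?T = "{\<tau>\<in>cells K. \<tau> \<noteq> \<sigma> \<and> int (cell_dim K \<tau>) \<le> ?n}"
  let ?im = "\<lambda>\<tau>. char_map K \<tau> ` topspace (unit_disc (cell_dim K \<tau>))"
  have top: "topspace ?X = skeleton K ?n"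
    using skeleton_subset_topspace by (simp add: Int_absorb1)
  have "closedin ?X (?im \<tau>)" if "\<tau> \<in> ?T" for \<tau>
  proof -
    have "compactin ?X (?im \<tau>)"
      by (rule image_compactin [OF _ continuous_map_char_map])
         (use that compact_space_unit_disc in \<open>auto simp: compact_space_def\<close>)
    moreover have "Hausdorff_space ?X"
      using cw by (auto simp: finite_cw_complex_def Hausdorff_space_subtopology)
    ultimately show ?thesis
      by (simp add: compactin_imp_closedin)
  qed
  moreover have "finite ?T"
    using cw by (auto simp: finite_cw_complex_def)
  ultimately have "closedin ?X (\<Union>\<tau>\<in>?T. ?im \<tau>)"
    by (intro closedin_Union) auto
  \<comment> \<open>An image of another disc consists of its own cell and points of a lower
    skeleton, and \<open>\<sigma>\<close> is disjoint from both.\<close>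
  moreover have "(\<Union>\<tau>\<in>?T. ?im \<tau>) = skeleton K ?n - \<sigma>"
  proof (intro subset_antisym subsetI)
    fix x assume "x \<in> (\<Union>\<tau>\<in>?T. ?im \<tau>)"
    then obtain \<tau> where \<tau>: "\<tau> \<in> cells K" "\<tau> \<noteq> \<sigma>" "int (cell_dim K \<tau>) \<le> ?n" and x: "x \<in> ?im \<tau>"
      by blast
    then have "x \<in> \<tau> \<union> skeleton K (int (cell_dim K \<tau>) - 1)"
      using char_map_image by blast
    moreover have "disjnt \<sigma> \<tau>" "disjnt \<sigma> (skeleton K (int (cell_dim K \<tau>) - 1))"
      using \<tau> assms by (auto intro: disjnt_cells disjnt_cell_skeleton)
    moreover have "\<tau> \<union> skeleton K (int (cell_dim K \<tau>) - 1) \<subseteq> skeleton K ?n"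
      using \<tau> by (auto simp: skeleton_def)
    ultimately show "x \<in> skeleton K ?n - \<sigma>"
      unfolding disjnt_iff by blast
  next
    fix x assume x: "x \<in> skeleton K ?n - \<sigma>"
    then obtain \<tau> where \<tau>: "\<tau> \<in> ?T" "x \<in> \<tau>"
      by (auto simp: skeleton_def)
    then have "x \<in> char_map K \<tau> ` disc_interior (cell_dim K \<tau>)"
      using char_map_interior by blast
    then show "x \<in> (\<Union>\<tau>\<in>?T. ?im \<tau>)"
      using \<tau> by (auto simp: disc_interior_def)
  qed
  ultimately have "closedin ?X (topspace ?X - \<sigma>)"
    by (simp only: top)
  then show ?thesis
    using cell_subset_skeleton [OF assms order_refl] top openin_closedin_eq by blast
qed

section \<open>Coefficients of cells read off in the local homology at a cell centre\<close>

definition to_local_homology :: "'a set \<Rightarrow> 'a chain set \<Rightarrow> 'a chain set" where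
  "to_local_homology \<sigma> =
     (let n = int (cell_dim K \<sigma>); X = subtopology (total_space K) (skeleton K n)
      in hom_induced n X (skeleton K (n - 1)) X (topspace X - {char_map K \<sigma> (\<lambda>_. 0)}) id)"

definition local_homology_group :: "'a set \<Rightarrow> 'a chain set monoid" where
  "local_homology_group \<sigma> =
     (let n = int (cell_dim K \<sigma>); X = subtopology (total_space K) (skeleton K n)
      in relative_homology_group n X (topspace X - {char_map K \<sigma> (\<lambda>_. 0)}))"

lemma comm_group_local_homology_group: "comm_group (local_homology_group \<sigma>)"
  by (simp add: local_homology_group_def Let_def)

lemma to_local_homology_hom: "to_local_homology \<sigma> \<in> hom (cellular_group K (int (cell_dim K \<sigma>))) (local_homology_group \<sigma>)"
  by (simp add: local_homology_group_def to_local_homology_def cellular_group_def Let_def hom_induced_hom)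

lemma char_map_centre:
  assumes "\<sigma> \<in> cells K"
  shows "char_map K \<sigma> (\<lambda>_. 0) \<in> \<sigma>"
  using char_map_interior [OF assms] zero_in_disc_interior by blast

text \<open>Both maps are induced by maps of pairs and may be composed, since the centre lies in the
  open cell and therefore outside the lower skeleton.\<close>

lemma to_local_homology_cell_class:
  assumes \<sigma>: "\<sigma> \<in> cells K" and \<tau>: "\<tau> \<in> cells K" "cell_dim K \<tau> = cell_dim K \<sigma>"
  defines "X \<equiv> subtopology (total_space K) (skeleton K (int (cell_dim K \<sigma>)))"
  shows "to_local_homology \<sigma> (cell_class K \<tau>) =
         hom_induced (int (cell_dim K \<sigma>)) (unit_disc (cell_dim K \<sigma>)) (disc_boundary (cell_dim K \<sigma>))
           X (topspace X - {char_map K \<sigma> (\<lambda>_. 0)}) (char_map K \<tau>) (orientation K \<tau>)"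
proof -
  let ?n = "int (cell_dim K \<sigma>)"
  have "skeleton K (?n - 1) \<subseteq> topspace X"
    using skeleton_mono [of "?n - 1" ?n] skeleton_subset_topspace by (auto simp: X_def)
  moreover have "char_map K \<sigma> (\<lambda>_. 0) \<notin> skeleton K (?n - 1)"
    using disjnt_cell_skeleton [OF \<sigma>, of "?n - 1"] char_map_centre [OF \<sigma>] by (auto simp: disjnt_iff)
  ultimately have "id \<in> skeleton K (?n - 1) \<rightarrow> topspace X - {char_map K \<sigma> (\<lambda>_. 0)}"
    by auto
  then show ?thesis
    unfolding to_local_homology_def cell_class_def Let_def X_def [symmetric] \<tau>(2)
    using char_map_boundary [OF \<tau>(1)] continuous_map_char_map [OF \<tau>(1), of ?n] \<tau>(2)
    by (subst hom_induced_compose') (auto simp: X_def)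
qed

text \<open>The closed cell of \<open>\<tau>\<close> misses the centre of \<open>\<sigma>\<close>,
  so the map of pairs factors through \<open>Q\<close> relative to itself.\<close>

lemma to_local_homology_cell_class_other:
  assumes \<sigma>: "\<sigma> \<in> cells K" and \<tau>: "\<tau> \<in> cells K" "cell_dim K \<tau> = cell_dim K \<sigma>" "\<tau> \<noteq> \<sigma>"
  shows "to_local_homology \<sigma> (cell_class K \<tau>) = \<one>\<^bsub>local_homology_group \<sigma>\<^esub>"
proof -
  define n where "n = cell_dim K \<sigma>"
  define X where "X = subtopology (total_space K) (skeleton K (int n))"
  define Q where "Q = topspace X - {char_map K \<sigma> (\<lambda>_. 0)}"
  have "char_map K \<sigma> (\<lambda>_. 0) \<notin> \<tau> \<union> skeleton K (int n - 1)"
    using disjnt_cells [OF \<sigma> \<tau>(1)] disjnt_cell_skeleton [OF \<sigma>, of "int n - 1"] char_map_centre [OF \<sigma>] \<tau>(3)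
    by (auto simp: disjnt_iff n_def)
  then have "char_map K \<tau> ` topspace (unit_disc n) \<subseteq> - {char_map K \<sigma> (\<lambda>_. 0)}"
    using char_map_image [OF \<tau>(1)] \<tau>(2) by (auto simp: n_def)
  moreover have cont: "continuous_map (unit_disc n) X (char_map K \<tau>)"
    using continuous_map_char_map [OF \<tau>(1), of "int n"] \<tau>(2) by (simp add: X_def n_def)
  then have "char_map K \<tau> ` topspace (unit_disc n) \<subseteq> topspace X"
    by (simp add: continuous_map_def image_subset_iff_funcset)
  ultimately have im: "char_map K \<tau> \<in> topspace (unit_disc n) \<rightarrow> Q"
    unfolding Q_def by blast
  have cQ: "continuous_map (unit_disc n) (subtopology X Q) (char_map K \<tau>)"
    using cont im by (auto simp: continuous_map_in_subtopology)
  have top: "topspace (subtopology X Q) = Q"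
    by (auto simp: Q_def)
  have bd: "disc_boundary n \<subseteq> topspace (unit_disc n)"
    by (auto simp: disc_boundary_def)
  let ?h = "hom_induced (int n) (unit_disc n) (disc_boundary n) (subtopology X Q) Q (char_map K \<tau>) (orientation K \<tau>)"
  have "to_local_homology \<sigma> (cell_class K \<tau>) =
        hom_induced (int n) (unit_disc n) (disc_boundary n) X Q (id \<circ> char_map K \<tau>) (orientation K \<tau>)"
    using to_local_homology_cell_class [OF \<sigma> \<tau>(1,2)] by (simp add: n_def X_def Q_def)
  \<comment> \<open>\<open>?h\<close> lives in the homology of \<open>Q\<close> relative to all of
    \<open>Q\<close>, a trivial group.\<close>
  also have "\<dots> = hom_induced (int n) (subtopology X Q) Q X Q id ?h"
    by (rule hom_induced_compose' [symmetric]) (use cQ im bd in auto)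
  also have "?h = \<one>\<^bsub>relative_homology_group (int n) (subtopology X Q) Q\<^esub>"
    using trivial_relative_homology_group_topspace [of "int n" "subtopology X Q"] top hom_induced_carrier
    by (metis (no_types, lifting) singletonD trivial_group_def)
  also have "hom_induced (int n) (subtopology X Q) Q X Q id \<dots> = \<one>\<^bsub>local_homology_group \<sigma>\<^esub>"
    unfolding local_homology_group_def Let_def n_def [symmetric] X_def [symmetric] Q_def [symmetric]
    by (rule hom_one [OF hom_induced_hom group_relative_homology_group group_relative_homology_group])
  finally show ?thesis .
qed

text \<open>The characteristic map is injective into local homology, so a trivial power downstairs
  comes from a trivial power of the orientation, a generator of an infinite cyclic group.\<close>

lemma to_local_homology_cell_class_self:
  assumes \<sigma>: "\<sigma> \<in> cells K" and or: "oriented_cells K"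
    and k: "to_local_homology \<sigma> (cell_class K \<sigma>) [^]\<^bsub>local_homology_group \<sigma>\<^esub> (k::int) = \<one>\<^bsub>local_homology_group \<sigma>\<^esub>"
  shows "k = 0"
proof -
  define n where "n = cell_dim K \<sigma>"
  define X where "X = subtopology (total_space K) (skeleton K (int n))"
  define G where "G = relative_homology_group (int n) (unit_disc n) (disc_boundary n)"
  have g: "orientation K \<sigma> \<in> carrier G" "generate G {orientation K \<sigma>} = carrier G"
    using or \<sigma> by (auto simp: oriented_cells_def Let_def G_def n_def)
  have G: "group G" by (simp add: G_def)
  have \<sigma>sk: "\<sigma> \<subseteq> skeleton K (int n)"
    using cell_subset_skeleton [OF \<sigma>] by (simp add: n_def)
  let ?h = "hom_induced (int n) (unit_disc n) (disc_boundary n) X (topspace X - {char_map K \<sigma> (\<lambda>_. 0)}) (char_map K \<sigma>)"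
  have hh: "?h \<in> hom G (local_homology_group \<sigma>)"
    by (simp add: G_def local_homology_group_def n_def X_def Let_def hom_induced_hom)
  then interpret group_hom G "local_homology_group \<sigma>" ?h
    using G comm_group_local_homology_group by (simp add: group_hom_def group_hom_axioms_def comm_group.axioms)
  have "?h (orientation K \<sigma> [^]\<^bsub>G\<^esub> k) = ?h (orientation K \<sigma>) [^]\<^bsub>local_homology_group \<sigma>\<^esub> k"
    by (rule hom_int_pow [OF g(1)])
  also have "\<dots> = \<one>\<^bsub>local_homology_group \<sigma>\<^esub>"
    using k to_local_homology_cell_class [OF \<sigma> \<sigma> refl] by (simp add: n_def X_def)
  finally have "orientation K \<sigma> [^]\<^bsub>G\<^esub> k = \<one>\<^bsub>G\<^esub>"
    unfolding G_def
  proof (intro hom_induced_char_map_eq_one)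
    show "continuous_map (unit_disc n) X (char_map K \<sigma>)"
      using continuous_map_char_map [OF \<sigma>] by (simp add: n_def X_def)
    show "homeomorphic_map (subtopology (unit_disc n) (disc_interior n)) (subtopology X \<sigma>) (char_map K \<sigma>)"
      using cw \<sigma> \<sigma>sk by (simp add: finite_cw_complex_def n_def X_def subtopology_subtopology Int_absorb1)
    show "openin X \<sigma>"
      using openin_skeleton_cell [OF \<sigma>] by (simp add: n_def X_def)
    have "Hausdorff_space X"
      using cw by (simp add: finite_cw_complex_def X_def Hausdorff_space_subtopology)
    moreover have "char_map K \<sigma> (\<lambda>_. 0) \<in> topspace X"
      using char_map_centre [OF \<sigma>] \<sigma>sk skeleton_subset_topspace by (auto simp: X_def)
    ultimately show "closedin X {char_map K \<sigma> (\<lambda>_. 0)}"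
      by (simp add: closedin_Hausdorff_singleton)
    show "char_map K \<sigma> ` disc_boundary n \<inter> \<sigma> = {}"
      using char_map_boundary [OF \<sigma>] disjnt_cell_skeleton [OF \<sigma>, of "int n - 1"]
      by (auto simp: n_def disjnt_iff)
    show "orientation K \<sigma> [^]\<^bsub>relative_homology_group (int n) (unit_disc n) (disc_boundary n)\<^esub> k
          \<in> carrier (relative_homology_group (int n) (unit_disc n) (disc_boundary n))"
      using g(1) by (simp add: G_def group.int_pow_closed)
  qed (simp add: local_homology_group_def n_def X_def Let_def)
  then show ?thesis
    using int_pow_generator_eq_one [OF G _ g] isomorphic_relative_homology_disc [of n]
    by (simp add: G_def)
qed

lemma cell_class_carrier: "cell_dim K \<sigma> = m \<Longrightarrow> cell_class K \<sigma> \<in> carrier (cellular_group K (int m))"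
  by (auto simp: cell_class_def cellular_group_def Let_def hom_induced_carrier)

text \<open>Apply the two connecting maps to the class of \<open>\<sigma>\<close> and read the
  result at the centre of \<open>\<rho>\<close>. Expanding by the incidence coefficients gives
  \<open>g\<close> to the power of the sum; composing the maps gives the neutral element; and
  \<open>g\<close> has infinite order.\<close>

lemma sum_incidence_incidence_codim2:
  assumes or: "oriented_cells K" and inc: "incidence_coefficients K"
    and \<sigma>: "\<sigma> \<in> cells K" "cell_dim K \<sigma> = Suc (Suc m)" and \<rho>: "\<rho> \<in> cells K" "cell_dim K \<rho> = m"
  shows "(\<Sum>\<tau>\<in>{\<tau>\<in>cells K. cell_dim K \<tau> = Suc m}. incidence K \<tau> \<rho> * incidence K \<sigma> \<tau>) = 0"
proof -
  define X where "X = (\<lambda>n. subtopology (total_space K) (skeleton K n))"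
  define C where "C = (\<lambda>n. {\<tau>\<in>cells K. cell_dim K \<tau> = n})"
  define g where "g = to_local_homology \<rho> (cell_class K \<rho>)"
  define r where "r = hom_relboundary (int (Suc m)) (X (int (Suc m))) (skeleton K (int m)) (skeleton K (int m - 1))"
  \<comment> \<open>On the class of an (m+1)-cell \<open>\<tau>\<close> this returns
    \<open>g\<close> to the power \<open>incidence K \<tau> \<rho>\<close>, since the other m-cells
    become trivial at the centre of \<open>\<rho>\<close>.\<close>
  define \<phi> where "\<phi> = to_local_homology \<rho> \<circ> r"
  let ?G = "\<lambda>n. cellular_group K (int n)" and ?L = "local_homology_group \<rho>"
  have XX: "subtopology (X n) (skeleton K m') = X m'" if "m' \<le> n" for n m'
    using skeleton_mono [OF that] by (simp add: X_def subtopology_subtopology Int_absorb1)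
  have Gm: "?G m = relative_homology_group (int m) (X (int m)) (skeleton K (int m - 1))"
    by (simp add: cellular_group_def X_def)
  have fin: "finite (C n)" for n
    using cw by (simp add: C_def finite_cw_complex_def)
  interpret L: comm_group ?L by (rule comm_group_local_homology_group)
  have cg: "comm_group (?G n)" for n
    by (simp add: cellular_group_def)
  have carr: "cell_class K \<in> C n \<rightarrow> carrier (?G n)" for n
    by (simp add: C_def cell_class_carrier)
  have l_hom: "to_local_homology \<rho> \<in> hom (?G m) ?L"
    using to_local_homology_hom [of \<rho>] \<rho> by simp
  have g: "g \<in> carrier ?L"
    unfolding g_def by (rule hom_in_carrier [OF l_hom cell_class_carrier [OF \<rho>(2)]])
  have "r \<in> hom (?G (Suc m)) (?G m)"
    using group_homomorphism_hom_relboundary [of "int (Suc m)" "X (int (Suc m))" "skeleton K (int m)" "skeleton K (int m - 1)"]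
      XX [of "int m" "int (Suc m)"] by (simp add: r_def cellular_group_def X_def)
  then have \<phi>_hom: "\<phi> \<in> hom (?G (Suc m)) ?L"
    unfolding \<phi>_def using l_hom by (rule hom_compose)
  have bd: "hom_relboundary (int (Suc n)) (X (int (Suc n))) (skeleton K (int n)) (skeleton K (int n - 1)) (cell_class K \<tau>)
            = (\<Otimes>\<^bsub>?G n\<^esub>\<upsilon>\<in>C n. cell_class K \<upsilon> [^]\<^bsub>?G n\<^esub> incidence K \<tau> \<upsilon>)"
    if "\<tau> \<in> cells K" "cell_dim K \<tau> = Suc n" for \<tau> n
    using inc that by (auto simp: incidence_coefficients_def X_def C_def)
  have \<phi>_cell: "\<phi> (cell_class K \<tau>) = g [^]\<^bsub>?L\<^esub> incidence K \<tau> \<rho>" if \<tau>: "\<tau> \<in> C (Suc m)" for \<tau>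
  proof -
    have "\<phi> (cell_class K \<tau>) = to_local_homology \<rho> (\<Otimes>\<^bsub>?G m\<^esub>\<upsilon>\<in>C m. cell_class K \<upsilon> [^]\<^bsub>?G m\<^esub> incidence K \<tau> \<upsilon>)"
      using bd [of \<tau> m] \<tau> by (simp add: \<phi>_def r_def C_def)
    also have "\<dots> = (\<Otimes>\<^bsub>?L\<^esub>\<upsilon>\<in>C m. to_local_homology \<rho> (cell_class K \<upsilon>) [^]\<^bsub>?L\<^esub> incidence K \<tau> \<upsilon>)"
      by (rule hom_finprod_int_pow [OF cg L.comm_group_axioms l_hom fin carr])
    also have "\<dots> = (\<Otimes>\<^bsub>?L\<^esub>\<upsilon>\<in>C m. if \<rho> = \<upsilon> then g [^]\<^bsub>?L\<^esub> incidence K \<tau> \<rho> else \<one>\<^bsub>?L\<^esub>)"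
    proof (rule L.finprod_cong' [OF refl])
      fix \<upsilon> assume \<upsilon>: "\<upsilon> \<in> C m"
      have "to_local_homology \<rho> (cell_class K \<upsilon>) = \<one>\<^bsub>?L\<^esub>" if "\<rho> \<noteq> \<upsilon>"
        by (rule to_local_homology_cell_class_other) (use \<upsilon> \<rho> that in \<open>simp_all add: C_def\<close>)
      then show "to_local_homology \<rho> (cell_class K \<upsilon>) [^]\<^bsub>?L\<^esub> incidence K \<tau> \<upsilon>
            = (if \<rho> = \<upsilon> then g [^]\<^bsub>?L\<^esub> incidence K \<tau> \<rho> else \<one>\<^bsub>?L\<^esub>)"
        by (simp add: g_def)
    qed (use g in \<open>simp add: Pi_iff\<close>)
    also have "\<dots> = g [^]\<^bsub>?L\<^esub> incidence K \<tau> \<rho>"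
      by (rule L.finprod_singleton [where f="\<lambda>_. g [^]\<^bsub>?L\<^esub> incidence K \<tau> \<rho>"]) (use \<rho> g fin in \<open>simp_all add: C_def\<close>)
    finally show ?thesis .
  qed
  have "g [^]\<^bsub>?L\<^esub> (\<Sum>\<tau>\<in>C (Suc m). incidence K \<tau> \<rho> * incidence K \<sigma> \<tau>)
        = (\<Otimes>\<^bsub>?L\<^esub>\<tau>\<in>C (Suc m). g [^]\<^bsub>?L\<^esub> (incidence K \<tau> \<rho> * incidence K \<sigma> \<tau>))"
    by (rule int_pow_sum_finprod [OF L.comm_group_axioms g fin, symmetric])
  also have "\<dots> = (\<Otimes>\<^bsub>?L\<^esub>\<tau>\<in>C (Suc m). \<phi> (cell_class K \<tau>) [^]\<^bsub>?L\<^esub> incidence K \<sigma> \<tau>)"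
    by (rule L.finprod_cong') (use g in \<open>simp_all add: \<phi>_cell L.int_pow_pow\<close>)
  also have "\<dots> = \<phi> (\<Otimes>\<^bsub>?G (Suc m)\<^esub>\<tau>\<in>C (Suc m). cell_class K \<tau> [^]\<^bsub>?G (Suc m)\<^esub> incidence K \<sigma> \<tau>)"
    by (rule hom_finprod_int_pow [OF cg L.comm_group_axioms \<phi>_hom fin carr, symmetric])
  also have "\<dots> = to_local_homology \<rho> (r (hom_relboundary (int (Suc (Suc m))) (X (int (Suc (Suc m)))) (skeleton K (int (Suc m)))
                     (skeleton K (int m)) (cell_class K \<sigma>)))"
    using bd [OF \<sigma>] by (simp add: \<phi>_def)
  also have "r (hom_relboundary (int (Suc (Suc m))) (X (int (Suc (Suc m)))) (skeleton K (int (Suc m)))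
                     (skeleton K (int m)) (cell_class K \<sigma>)) = \<one>\<^bsub>?G m\<^esub>"
    unfolding r_def
    by (subst hom_relboundary_hom_relboundary) (simp_all add: XX Gm)
  also have "to_local_homology \<rho> \<one>\<^bsub>?G m\<^esub> = \<one>\<^bsub>?L\<^esub>"
    by (rule hom_one [OF l_hom comm_group.axioms(2) [OF cg] L.is_group])
  finally show ?thesis
    using to_local_homology_cell_class_self [OF \<rho>(1) or] by (simp add: g_def C_def)
qed

text \<open>Unless the dimensions differ by exactly two, one factor of every summand vanishes for
  reasons of dimension.\<close>

lemma sum_incidence_incidence:
  assumes or: "oriented_cells K" and inc: "incidence_coefficients K"
    and \<sigma>: "\<sigma> \<in> cells K" and \<rho>: "\<rho> \<in> cells K"
  shows "(\<Sum>\<tau>\<in>cells K. incidence K \<tau> \<rho> * incidence K \<sigma> \<tau>) = 0"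
proof (cases "cell_dim K \<sigma> = Suc (Suc (cell_dim K \<rho>))")
  case True
  have "finite (cells K)"
    using cw by (simp add: finite_cw_complex_def)
  then have "(\<Sum>\<tau>\<in>cells K. incidence K \<tau> \<rho> * incidence K \<sigma> \<tau>) =
        (\<Sum>\<tau>\<in>{\<tau>\<in>cells K. cell_dim K \<tau> = Suc (cell_dim K \<rho>)}. incidence K \<tau> \<rho> * incidence K \<sigma> \<tau>)"
    using inc \<rho> by (intro sum.mono_neutral_right) (auto simp: incidence_coefficients_def)
  then show ?thesis
    using sum_incidence_incidence_codim2 [OF or inc \<sigma> True \<rho> refl] by simp
next
  case False
  have "incidence K \<tau> \<rho> = 0 \<or> incidence K \<sigma> \<tau> = 0" if "\<tau> \<in> cells K" for \<tau>
    using inc \<sigma> \<rho> that False unfolding incidence_coefficients_def by (metis Suc_eq_plus1)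
  then show ?thesis
    by (intro sum.neutral ballI) simp
qed

end


subsection \<open>Chains, boundaries and homology classes\<close>

lemma cellular_boundary_lincomb:
  "cellular_boundary K (\<lambda>\<sigma>. \<Sum>v\<in>I. w v * f v \<sigma>) = (\<lambda>\<tau>. \<Sum>v\<in>I. w v * cellular_boundary K (f v) \<tau>)"
proof
  fix \<tau>
  have "(\<Sum>\<sigma>\<in>cells K. (\<Sum>v\<in>I. w v * f v \<sigma>) * of_int (incidence K \<sigma> \<tau>)) =
        (\<Sum>v\<in>I. w v * (\<Sum>\<sigma>\<in>cells K. f v \<sigma> * of_int (incidence K \<sigma> \<tau>)))"
    unfolding sum_distrib_right sum_distrib_left by (subst sum.swap) (simp add: mult.assoc)
  then show "cellular_boundary K (\<lambda>\<sigma>. \<Sum>v\<in>I. w v * f v \<sigma>) \<tau> = (\<Sum>v\<in>I. w v * cellular_boundary K (f v) \<tau>)"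
    by (simp add: cellular_boundary_def)
qed

lemma cellular_boundary_diff:
  "cellular_boundary K (\<lambda>\<sigma>. f \<sigma> - g \<sigma>) = (\<lambda>\<tau>. cellular_boundary K f \<tau> - cellular_boundary K g \<tau>)"
  by (auto simp: cellular_boundary_def left_diff_distrib sum_subtractf)

lemma cellular_boundary_scale:
  "cellular_boundary K (\<lambda>\<sigma>. a * f \<sigma>) = (\<lambda>\<tau>. a * cellular_boundary K f \<tau>)"
  by (auto simp: cellular_boundary_def sum_distrib_left mult.assoc)

lemma chainsI:
  "(\<And>\<sigma>. c \<sigma> \<noteq> 0 \<Longrightarrow> \<sigma> \<in> cells K \<and> \<sigma> \<in> A \<and> cell_dim K \<sigma> = q) \<Longrightarrow> c \<in> chains K q A"
  by (simp add: chains_def)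

lemma chainsD:
  assumes "c \<in> chains K q A" "c \<sigma> \<noteq> 0"
  shows "\<sigma> \<in> cells K" "\<sigma> \<in> A" "cell_dim K \<sigma> = q"
  using assms by (auto simp: chains_def)

lemma chains_lincomb:
  assumes "\<And>v. v \<in> I \<Longrightarrow> f v \<in> chains K q A"
  shows "(\<lambda>\<sigma>. \<Sum>v\<in>I. w v * f v \<sigma>) \<in> chains K q A"
proof (rule chainsI)
  fix \<sigma> assume "(\<Sum>v\<in>I. w v * f v \<sigma>) \<noteq> 0"
  then obtain v where "v \<in> I" "w v * f v \<sigma> \<noteq> 0"
    by (rule sum.not_neutral_contains_not_neutral)
  then show "\<sigma> \<in> cells K \<and> \<sigma> \<in> A \<and> cell_dim K \<sigma> = q"
    using chainsD [OF assms] by (metis mult_zero_right)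
qed

lemma chains_diff:
  assumes "f \<in> chains K q A" "g \<in> chains K q A"
  shows "(\<lambda>\<sigma>. f \<sigma> - g \<sigma>) \<in> chains K q A"
proof (rule chainsI)
  fix \<sigma> assume "f \<sigma> - g \<sigma> \<noteq> 0"
  then have "f \<sigma> \<noteq> 0 \<or> g \<sigma> \<noteq> 0"
    by auto
  then show "\<sigma> \<in> cells K \<and> \<sigma> \<in> A \<and> cell_dim K \<sigma> = q"
    using chainsD [OF assms(1)] chainsD [OF assms(2)] by blast
qed

lemma chains_mono: "A \<subseteq> B \<Longrightarrow> chains K q A \<subseteq> chains K q B"
  by (auto simp: chains_def)

lemma boundaries_mono: "A \<subseteq> B \<Longrightarrow> boundaries K q A \<subseteq> boundaries K q B"
  using chains_mono unfolding boundaries_def by blast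

lemma boundaries_lincomb:
  assumes "\<And>v. v \<in> I \<Longrightarrow> f v \<in> boundaries K q A"
  shows "(\<lambda>\<sigma>. \<Sum>v\<in>I. w v * f v \<sigma>) \<in> boundaries K q A"
proof -
  have "\<forall>v\<in>I. \<exists>x. x \<in> chains K (q + 1) A \<and> f v = cellular_boundary K x"
    using assms unfolding boundaries_def by blast
  then obtain x where x: "\<And>v. v \<in> I \<Longrightarrow> x v \<in> chains K (q + 1) A"
    and f: "\<And>v. v \<in> I \<Longrightarrow> f v = cellular_boundary K (x v)"
    by metis
  have "(\<lambda>\<sigma>. \<Sum>v\<in>I. w v * f v \<sigma>) = cellular_boundary K (\<lambda>\<sigma>. \<Sum>v\<in>I. w v * x v \<sigma>)"
    unfolding cellular_boundary_lincomb by (intro ext sum.cong) (simp_all add: f)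
  then show ?thesis
    unfolding boundaries_def by (simp only:) (intro imageI chains_lincomb x)
qed

lemma boundaries_zero: "(\<lambda>_. 0) \<in> boundaries K q A"
  using boundaries_lincomb [of "{}" "\<lambda>_ _. 0" K q A "\<lambda>_. 0"] by simp

lemma boundaries_scale: "f \<in> boundaries K q A \<Longrightarrow> (\<lambda>\<sigma>. a * f \<sigma>) \<in> boundaries K q A"
  using boundaries_lincomb [of "{()}" "\<lambda>_. f" K q A "\<lambda>_. a"] by simp

lemma boundaries_diff:
  assumes "f \<in> boundaries K q A" "g \<in> boundaries K q A"
  shows "(\<lambda>\<sigma>. f \<sigma> - g \<sigma>) \<in> boundaries K q A"
proof -
  obtain x y where "x \<in> chains K (q + 1) A" "y \<in> chains K (q + 1) A"
    and fg: "f = cellular_boundary K x" "g = cellular_boundary K y"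
    using assms unfolding boundaries_def by blast
  then have "(\<lambda>\<sigma>. x \<sigma> - y \<sigma>) \<in> chains K (q + 1) A"
    by (intro chains_diff)
  then show ?thesis
    unfolding boundaries_def fg cellular_boundary_diff [symmetric] by (rule imageI)
qed

lemma boundaries_add:
  assumes "f \<in> boundaries K q A" "g \<in> boundaries K q A"
  shows "(\<lambda>\<sigma>. f \<sigma> + g \<sigma>) \<in> boundaries K q A"
  using boundaries_diff [OF assms(1) boundaries_scale [OF assms(2), of "-1"]] by simp

section \<open>Homology classes as sets of cycles\<close>

lemma homology_class_eqI:
  assumes "(\<lambda>\<sigma>. z \<sigma> - y \<sigma>) \<in> boundaries K q A"
  shows "homology_class K q A z = homology_class K q A y"
  unfolding homology_class_def
proof (intro Collect_cong conj_cong refl iffI)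
  fix x
  show "(\<lambda>\<sigma>. x \<sigma> - y \<sigma>) \<in> boundaries K q A" if "(\<lambda>\<sigma>. x \<sigma> - z \<sigma>) \<in> boundaries K q A"
    using boundaries_add [OF that assms] by (simp add: algebra_simps)
  show "(\<lambda>\<sigma>. x \<sigma> - z \<sigma>) \<in> boundaries K q A" if "(\<lambda>\<sigma>. x \<sigma> - y \<sigma>) \<in> boundaries K q A"
    using boundaries_diff [OF that assms] by (simp add: algebra_simps)
qed

lemma homology_class_self: "z \<in> cycles K q A \<Longrightarrow> z \<in> homology_class K q A z"
  by (simp add: homology_class_def boundaries_zero)

text \<open>A cycle belongs to its own class, so the class is nonempty and an equality of classes
  carries information.\<close>

lemma homology_class_eq_iff:
  assumes "z \<in> cycles K q A"
  shows "homology_class K q A z = homology_class K q A y \<longleftrightarrow> (\<lambda>\<sigma>. z \<sigma> - y \<sigma>) \<in> boundaries K q A"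
proof
  assume "homology_class K q A z = homology_class K q A y"
  then have "z \<in> homology_class K q A y"
    using homology_class_self [OF assms] by simp
  then show "(\<lambda>\<sigma>. z \<sigma> - y \<sigma>) \<in> boundaries K q A"
    by (simp add: homology_class_def)
qed (rule homology_class_eqI)

text \<open>The union defining the map ranges over representatives that all give the same class, and
  \<open>z\<close> itself is one of them.\<close>

lemma inclusion_map_homology_class:
  assumes "A \<subseteq> B" "z \<in> cycles K q A"
  shows "inclusion_map K q B (homology_class K q A z) = homology_class K q B z"
proof -
  have "homology_class K q B z' = homology_class K q B z" if "z' \<in> homology_class K q A z" for z'
  proof (rule homology_class_eqI)
    show "(\<lambda>\<sigma>. z' \<sigma> - z \<sigma>) \<in> boundaries K q B"
      using that boundaries_mono [OF assms(1), of K q] unfolding homology_class_def by blast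
  qed
  then show ?thesis
    using homology_class_self [OF assms(2)] unfolding inclusion_map_def by blast
qed

text \<open>Changing the representatives changes the combination by a boundary, so every choice
  yields the same set, and \<open>z\<close> is an admissible choice.\<close>

lemma class_lincomb_homology_class:
  assumes "\<And>v. v \<in> I \<Longrightarrow> z v \<in> cycles K q A"
  shows "class_lincomb K q A w I (\<lambda>v. homology_class K q A (z v)) =
         homology_class K q A (\<lambda>\<sigma>. \<Sum>v\<in>I. w v * z v \<sigma>)"
proof -
  let ?R = "{r. \<forall>v\<in>I. r v \<in> homology_class K q A (z v)}"
  have "homology_class K q A (\<lambda>\<sigma>. \<Sum>v\<in>I. w v * r v \<sigma>) = homology_class K q A (\<lambda>\<sigma>. \<Sum>v\<in>I. w v * z v \<sigma>)"
    if "r \<in> ?R" for r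
  proof (rule homology_class_eqI)
    have "(\<lambda>\<sigma>. \<Sum>v\<in>I. w v * (r v \<sigma> - z v \<sigma>)) \<in> boundaries K q A"
      by (rule boundaries_lincomb) (use that in \<open>simp add: homology_class_def\<close>)
    then show "(\<lambda>\<sigma>. (\<Sum>v\<in>I. w v * r v \<sigma>) - (\<Sum>v\<in>I. w v * z v \<sigma>)) \<in> boundaries K q A"
      by (simp add: right_diff_distrib sum_subtractf)
  qed
  moreover have "z \<in> ?R"
    using homology_class_self assms by blast
  ultimately show ?thesis
    unfolding class_lincomb_def by blast
qed

subsection \<open>Reduced matrices\<close>

lemma zero_col_entry:
  "col M j = 0\<^sub>v (dim_row M) \<Longrightarrow> r < dim_row M \<Longrightarrow> j < dim_col M \<Longrightarrow> M $$ (r, j) = 0"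
  by (metis index_col index_zero_vec(1))

lemma low_nonzero:
  assumes "j < dim_col M" "col M j \<noteq> 0\<^sub>v (dim_row M)"
  shows "low M j < dim_row M" "M $$ (low M j, j) \<noteq> 0"
    and "\<And>r. low M j < r \<Longrightarrow> r < dim_row M \<Longrightarrow> M $$ (r, j) = 0"
proof -
  let ?S = "{r. r < dim_row M \<and> M $$ (r, j) \<noteq> 0}"
  have "?S \<noteq> {}"
  proof
    assume "?S = {}"
    then have "col M j = 0\<^sub>v (dim_row M)"
      using assms(1) by (intro eq_vecI) auto
    then show False using assms(2) by simp
  qed
  then have "low M j \<in> ?S"
    unfolding low_def by (intro Max_in) auto
  then show "low M j < dim_row M" "M $$ (low M j, j) \<noteq> 0"
    by auto
  show "M $$ (r, j) = 0" if r: "low M j < r" "r < dim_row M" for r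
  proof (rule ccontr)
    assume "M $$ (r, j) \<noteq> 0"
    then have "r \<le> low M j"
      unfolding low_def using r by (intro Max_ge) auto
    then show False using r by simp
  qed
qed

text \<open>Distinct nonzero columns have distinct lows. Hence the largest low among the columns
  that occur is met by just one of them, and its entry cannot cancel.\<close>

lemma reduced_lincomb_low:
  assumes red: "reduced M" and n: "n \<le> dim_col M"
    and ex: "j\<^sub>0 < n" "y j\<^sub>0 \<noteq> 0" "col M j\<^sub>0 \<noteq> 0\<^sub>v (dim_row M)"
  obtains j where "j < n" "y j \<noteq> 0" "col M j \<noteq> 0\<^sub>v (dim_row M)"
    "(\<Sum>l<n. y l * M $$ (low M j, l)) \<noteq> 0"
    "\<And>r. low M j < r \<Longrightarrow> r < dim_row M \<Longrightarrow> (\<Sum>l<n. y l * M $$ (r, l)) = 0"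
proof -
  \<comment> \<open>The columns that really contribute; \<open>j\<close> is then chosen with the
    largest low among them.\<close>
  define J where "J = {j. j < n \<and> y j \<noteq> 0 \<and> col M j \<noteq> 0\<^sub>v (dim_row M)}"
  have J: "finite J" "J \<noteq> {}"
    using ex by (auto simp: J_def)
  then have "Max (low M ` J) \<in> low M ` J"
    by (intro Max_in) auto
  then obtain j where j: "j \<in> J" "low M j = Max (low M ` J)"
    by auto
  have le: "low M l \<le> low M j" if "l \<in> J" for l
    using that j J by simp
  have less: "low M l < low M j" if "l \<in> J" "l \<noteq> j" for l
  proof -
    have "l < dim_col M" "j < dim_col M"
      using that j n by (auto simp: J_def)
    then have "low M l \<noteq> low M j"
      using that j red unfolding reduced_def J_def by blast
    then show ?thesis using le [OF that(1)] by simp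
  qed
  have zero: "y l * M $$ (r, l) = 0" if "l < n" "r < dim_row M" "l \<in> J \<Longrightarrow> low M l < r" for l r
  proof (cases "l \<in> J")
    case True
    then show ?thesis
      using that n low_nonzero(3) [of l M r] by (auto simp: J_def)
  next
    case False
    then have "y l = 0 \<or> col M l = 0\<^sub>v (dim_row M)"
      using that by (auto simp: J_def)
    then show ?thesis
      using zero_col_entry [of M l r] that n by auto
  qed
  show thesis
  proof
    show "j < n" "y j \<noteq> 0" and c: "col M j \<noteq> 0\<^sub>v (dim_row M)"
      using j by (auto simp: J_def)
    note lj = low_nonzero [OF less_le_trans [OF \<open>j < n\<close> n] c]
    have "(\<Sum>l<n. y l * M $$ (low M j, l)) = (\<Sum>l\<in>{j}. y l * M $$ (low M j, l))"
    proof (rule sum.mono_neutral_right)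
      show "\<forall>l\<in>{..<n} - {j}. y l * M $$ (low M j, l) = 0"
        by (intro ballI zero less lj(1)) auto
    qed (use \<open>j < n\<close> in auto)
    then show "(\<Sum>l<n. y l * M $$ (low M j, l)) \<noteq> 0"
      using lj(2) \<open>y j \<noteq> 0\<close> by simp
    show "(\<Sum>l<n. y l * M $$ (r, l)) = 0" if "low M j < r" "r < dim_row M" for r
    proof (intro sum.neutral ballI zero)
      show "low M l < r" if "l \<in> J" for l
        using le [OF that] \<open>low M j < r\<close> by simp
    qed (use that in auto)
  qed
qed

subsection \<open>Persistence pairs\<close>

text \<open>Two partners of \<open>i\<close> would be two nonzero columns with the same low.\<close>

lemma pair_index_eq:
  assumes "reduced R" "dim_row R = num_cells K" "dim_col R = num_cells K" "(i, j) \<in> persistence_pairs K R"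
  shows "pair_index K R i = enat j"
proof -
  have "j' = j" if "(i, j') \<in> persistence_pairs K R" for j'
    using assms that unfolding persistence_pairs_def reduced_def by force
  then have "(THE j. (i, j) \<in> persistence_pairs K R) = j"
    using assms(4) by blast
  then show ?thesis
    using assms(4) unfolding pair_index_def by auto
qed

lemma death_pair:
  assumes "reduced R" "dim_row R = num_cells K" "dim_col R = num_cells K" "(i, j) \<in> persistence_pairs K R"
  shows "death K R i = ereal (filt K (cell_at K j))"
  using pair_index_eq [OF assms] by (simp add: death_def)

lemma finite_death_pair:
  assumes "reduced R" "dim_row R = num_cells K" "dim_col R = num_cells K" "death K R i < \<infinity>"
  obtains j where "(i, j) \<in> persistence_pairs K R" "death K R i = ereal (filt K (cell_at K j))"
proof (cases "\<exists>j. (i, j) \<in> persistence_pairs K R")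
  case True
  then show ?thesis
    using that death_pair [OF assms(1-3)] by blast
next
  case False
  then show ?thesis
    using assms(4) by (simp add: death_def pair_index_def)
qed

section \<open>Cells by index, and matrix columns as chains\<close>

context
  fixes K :: "'a filtered_cw"
  assumes cell_order: "compatible_cell_order K"
begin

lemma bij_cell_at: "bij_betw (cell_at K) {..<num_cells K} (cells K)"
  using cell_order by (simp add: compatible_cell_order_def)

lemma cell_at_in_cells: "j < num_cells K \<Longrightarrow> cell_at K j \<in> cells K"
  using bij_cell_at by (auto simp: bij_betw_def)

lemma cells_cell_at:
  assumes "\<sigma> \<in> cells K"
  obtains j where "j < num_cells K" "\<sigma> = cell_at K j"
  using cell_order assms unfolding compatible_cell_order_def bij_betw_def by blast

lemma filt_mono: "i \<le> j \<Longrightarrow> j < num_cells K \<Longrightarrow> filt K (cell_at K i) \<le> filt K (cell_at K j)"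
  using cell_order unfolding compatible_cell_order_def
  by (metis le_less_trans linorder_not_le)

lemma column_chain_cell_at: "r < num_cells K \<Longrightarrow> column_chain K M j (cell_at K r) = M $$ (r, j)"
  using bij_betw_inv_into_left [OF bij_cell_at, of r] cell_at_in_cells [of r]
  by (simp add: column_chain_def)

lemma column_chain_outside: "\<sigma> \<notin> cells K \<Longrightarrow> column_chain K M j \<sigma> = 0"
  by (simp add: column_chain_def)

lemma chain_eqI:
  assumes "\<And>\<sigma>. \<sigma> \<notin> cells K \<Longrightarrow> f \<sigma> = g \<sigma>"
    and "\<And>r. r < num_cells K \<Longrightarrow> f (cell_at K r) = g (cell_at K r)"
  shows "f = g"
proof
  fix \<sigma>
  show "f \<sigma> = g \<sigma>"
  proof (cases "\<sigma> \<in> cells K")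
    case True
    then show ?thesis
      using assms(2) by (metis cells_cell_at)
  qed (rule assms(1))
qed

lemma cellular_boundary_cell_at:
  assumes "r < num_cells K"
  shows "cellular_boundary K c (cell_at K r) =
         (\<Sum>j<num_cells K. c (cell_at K j) * of_int (incidence K (cell_at K j) (cell_at K r)))"
  using sum.reindex_bij_betw [OF bij_cell_at, of "\<lambda>\<sigma>. c \<sigma> * of_int (incidence K \<sigma> (cell_at K r))"]
    cell_at_in_cells [OF assms] by (simp add: cellular_boundary_def)

lemma cellular_boundary_column_chain:
  assumes "M \<in> carrier_mat (num_cells K) (num_cells K)" "j < num_cells K"
  shows "cellular_boundary K (column_chain K M j) = column_chain K (boundary_matrix K * M) j"
proof (rule chain_eqI)
  show "cellular_boundary K (column_chain K M j) \<sigma> = column_chain K (boundary_matrix K * M) j \<sigma>" if "\<sigma> \<notin> cells K" for \<sigma>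
    using that by (simp add: cellular_boundary_def column_chain_outside)
  show "cellular_boundary K (column_chain K M j) (cell_at K r) = column_chain K (boundary_matrix K * M) j (cell_at K r)"
    if r: "r < num_cells K" for r
    using assms that
    by (simp add: cellular_boundary_cell_at column_chain_cell_at boundary_matrix_def scalar_prod_def
        lessThan_atLeast0 mult.commute)
qed

end

lemma cellular_boundary_boundary:
  fixes c :: "'a set \<Rightarrow> 'k::field"
  assumes dd: "\<And>\<sigma> \<rho>. \<sigma> \<in> cells K \<Longrightarrow> \<rho> \<in> cells K \<Longrightarrow> (\<Sum>\<tau>\<in>cells K. incidence K \<tau> \<rho> * incidence K \<sigma> \<tau>) = 0"
  shows "cellular_boundary K (cellular_boundary K c) = (\<lambda>_. 0)"
proof
  fix \<rho>
  show "cellular_boundary K (cellular_boundary K c) \<rho> = 0"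
  proof (cases "\<rho> \<in> cells K")
    case True
    have "(\<Sum>\<tau>\<in>cells K. (\<Sum>\<sigma>\<in>cells K. c \<sigma> * of_int (incidence K \<sigma> \<tau>)) * of_int (incidence K \<tau> \<rho>))
        = (\<Sum>\<sigma>\<in>cells K. c \<sigma> * of_int (\<Sum>\<tau>\<in>cells K. incidence K \<tau> \<rho> * incidence K \<sigma> \<tau>))"
      unfolding sum_distrib_right of_int_sum sum_distrib_left
      by (subst sum.swap) (simp add: mult_ac)
    also have "\<dots> = 0"
      using dd True by simp
    finally show ?thesis
      using True by (simp add: cellular_boundary_def)
  qed (simp add: cellular_boundary_def)
qed


subsection \<open>Transition coefficients\<close>

context
  fixes K :: "'a filtered_cw" and R V :: "'k::field mat"
  assumes cell_order: "compatible_cell_order K"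
    and red: "reduction K R V"
begin

lemma reduction_dim: "V \<in> carrier_mat (num_cells K) (num_cells K)"
    "R \<in> carrier_mat (num_cells K) (num_cells K)" "dim_row R = num_cells K" "dim_col R = num_cells K"
    and reduced_R: "reduced R"
  using red by (auto simp: reduction_def boundary_matrix_def)

lemma V_diag: "j < num_cells K \<Longrightarrow> V $$ (j, j) = 1"
  using red by (simp add: reduction_def)

lemma V_below_diag: "r < num_cells K \<Longrightarrow> j < r \<Longrightarrow> V $$ (r, j) = 0"
  using red by (auto simp: reduction_def upper_triangular_def)

lemma cellular_boundary_V:
  "j < num_cells K \<Longrightarrow> cellular_boundary K (column_chain K V j) = column_chain K R j"
  using cellular_boundary_column_chain [OF cell_order reduction_dim(1)] red by (simp add: reduction_def)

lemma column_chain_V_support: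
  assumes "j < num_cells K" "column_chain K V j \<sigma> \<noteq> 0"
  obtains r where "r \<le> j" "\<sigma> = cell_at K r" "cell_dim K \<sigma> = cell_dim K (cell_at K j)"
proof -
  have "\<sigma> \<in> cells K"
    using assms(2) by (auto simp: column_chain_def split: if_splits)
  then obtain r where r: "r < num_cells K" "\<sigma> = cell_at K r"
    by (rule cells_cell_at [OF cell_order])
  then have nz: "V $$ (r, j) \<noteq> 0"
    using assms(2) by (simp add: column_chain_cell_at [OF cell_order])
  have "r \<le> j"
    using V_below_diag [OF r(1), of j] nz by (meson not_le)
  moreover have "cell_dim K \<sigma> = cell_dim K (cell_at K j)"
    unfolding r(2) using red nz r(1) assms(1) unfolding reduction_def by blast
  ultimately show thesis
    using that r(2) by blast
qed

text \<open>\<open>V\<close> is unitriangular, so its first \<open>n\<close> columns span the chains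
  on the first \<open>n\<close> cells. As \<open>V\<close> preserves dimension, a chain of pure
  dimension \<open>p\<close> uses only columns of that dimension.\<close>

lemma column_expansion:
  assumes "n \<le> num_cells K"
    and "\<And>\<sigma>. c \<sigma> \<noteq> 0 \<Longrightarrow> (\<exists>j<n. \<sigma> = cell_at K j) \<and> cell_dim K \<sigma> = p"
  shows "\<exists>y. c = (\<lambda>\<sigma>. \<Sum>j<n. y j * column_chain K V j \<sigma>) \<and>
             (\<forall>j<n. y j \<noteq> 0 \<longrightarrow> cell_dim K (cell_at K j) = p)"
  using assms
proof (induction n arbitrary: c)
  case 0
  then have "c = (\<lambda>_. 0)" by auto
  then show ?case by auto
next
  case (Suc n)
  \<comment> \<open>The diagonal entry of column \<open>n\<close> is 1, so subtracting
    \<open>a\<close> times this column clears the last coordinate.\<close>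
  define a where "a = c (cell_at K n)"
  define c' where "c' = (\<lambda>\<sigma>. c \<sigma> - a * column_chain K V n \<sigma>)"
  have n: "n < num_cells K" using Suc.prems by simp
  have a_dim: "cell_dim K (cell_at K n) = p" if "a \<noteq> 0"
    using Suc.prems(2) that by (auto simp: a_def)
  have c': "(\<exists>j<n. \<sigma> = cell_at K j) \<and> cell_dim K \<sigma> = p" if nz: "c' \<sigma> \<noteq> 0" for \<sigma>
  proof -
    have "(\<exists>j<Suc n. \<sigma> = cell_at K j) \<and> cell_dim K \<sigma> = p"
    proof (cases "c \<sigma> = 0")
      case True
      then have a: "a \<noteq> 0" and "column_chain K V n \<sigma> \<noteq> 0"
        using nz by (auto simp: c'_def)
      then obtain r where "r \<le> n" "\<sigma> = cell_at K r" "cell_dim K \<sigma> = cell_dim K (cell_at K n)"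
        using column_chain_V_support [OF n] by blast
      then show ?thesis
        using a_dim [OF a] by (auto simp: less_Suc_eq_le)
    next
      case False
      then show ?thesis by (rule Suc.prems(2))
    qed
    moreover have "c' (cell_at K n) = 0"
      by (simp add: c'_def a_def column_chain_cell_at [OF cell_order n] V_diag [OF n])
    ultimately show ?thesis
      using nz by (metis less_SucE)
  qed
  obtain y where y: "c' = (\<lambda>\<sigma>. \<Sum>j<n. y j * column_chain K V j \<sigma>)"
      "\<And>j. j < n \<Longrightarrow> y j \<noteq> 0 \<Longrightarrow> cell_dim K (cell_at K j) = p"
    using Suc.IH [OF _ c'] n by auto
  have "c = (\<lambda>\<sigma>. c' \<sigma> + a * column_chain K V n \<sigma>)"
    by (simp add: c'_def)
  then have "c = (\<lambda>\<sigma>. \<Sum>j<Suc n. (y(n := a)) j * column_chain K V j \<sigma>)"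
    unfolding y(1) by simp
  moreover have "\<forall>j<Suc n. (y(n := a)) j \<noteq> 0 \<longrightarrow> cell_dim K (cell_at K j) = p"
    using y(2) a_dim by (auto simp: less_Suc_eq)
  ultimately show ?case by blast
qed

lemma cellular_boundary_expansion:
  assumes "n \<le> num_cells K" "r < num_cells K"
  shows "cellular_boundary K (\<lambda>\<sigma>. \<Sum>j<n. y j * column_chain K V j \<sigma>) (cell_at K r) = (\<Sum>j<n. y j * R $$ (r, j))"
  unfolding cellular_boundary_lincomb
  by (rule sum.cong) (use assms in \<open>simp_all add: cellular_boundary_V column_chain_cell_at [OF cell_order]\<close>)

section \<open>Birth cycles in the sublevel complexes\<close>

lemma positive_cycle:
  assumes "positive K R j"
  shows "cellular_boundary K (column_chain K V j) = (\<lambda>_. 0)"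
proof -
  have j: "j < num_cells K" "col R j = 0\<^sub>v (num_cells K)"
    using assms by (auto simp: positive_def)
  have "R $$ (r, j) = 0" if "r < num_cells K" for r
    using zero_col_entry [of R j r] that j reduction_dim by simp
  then have "column_chain K R j = (\<lambda>_. 0)"
    by (intro chain_eqI [OF cell_order]) (auto simp: column_chain_outside [OF cell_order] column_chain_cell_at [OF cell_order])
  then show ?thesis
    using j cellular_boundary_V by simp
qed

lemma column_chain_V_chains:
  assumes j: "j < num_cells K" "cell_dim K (cell_at K j) = q"
    and A: "\<And>\<sigma>. \<sigma> \<in> cells K \<Longrightarrow> filt K \<sigma> \<le> filt K (cell_at K j) \<Longrightarrow> \<sigma> \<in> A"
  shows "column_chain K V j \<in> chains K q A"
proof (rule chainsI)
  fix \<sigma> assume nz: "column_chain K V j \<sigma> \<noteq> 0"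
  obtain r where r: "r \<le> j" "\<sigma> = cell_at K r" "cell_dim K \<sigma> = cell_dim K (cell_at K j)"
    by (rule column_chain_V_support [OF j(1) nz])
  then have "\<sigma> \<in> cells K"
    using cell_at_in_cells [OF cell_order, of r] j by simp
  then show "\<sigma> \<in> cells K \<and> \<sigma> \<in> A \<and> cell_dim K \<sigma> = q"
    using A r j filt_mono [OF cell_order r(1) j(1)] by simp
qed

lemma positive_cycles_sublevel:
  assumes "positive K R j" "cell_dim K (cell_at K j) = q" "birth K j \<le> t"
  shows "column_chain K V j \<in> cycles K q (sublevel K t)"
  using assms positive_cycle column_chain_V_chains [of j q "sublevel K t"]
  by (auto simp: cycles_def sublevel_def positive_def birth_def)

lemma positive_cycles_strict_sublevel:
  assumes "positive K R j" "cell_dim K (cell_at K j) = q" "birth K j < t"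
  shows "column_chain K V j \<in> cycles K q (strict_sublevel K t)"
  using assms positive_cycle column_chain_V_chains [of j q "strict_sublevel K t"]
  by (auto simp: cycles_def strict_sublevel_def positive_def birth_def)

text \<open>Filtration values do not decrease along the order. Chains in \<open>sublevel K t\<close>
  are thereby combinations of the first \<open>n\<close> columns of \<open>V\<close>.\<close>

lemma sublevel_initial_segment:
  obtains n where "n \<le> num_cells K" "\<And>j. j < num_cells K \<Longrightarrow> filt K (cell_at K j) \<le> t \<longleftrightarrow> j < n"
proof -
  let ?P = "\<lambda>n. \<forall>j<num_cells K. filt K (cell_at K j) \<le> t \<longrightarrow> j < n"
  define n where "n = (LEAST n. ?P n)"
  have P: "?P n"
    unfolding n_def by (rule LeastI [of ?P "num_cells K"]) simp
  show thesis
  proof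
    show "n \<le> num_cells K"
      unfolding n_def by (rule Least_le) simp
    show "filt K (cell_at K j) \<le> t \<longleftrightarrow> j < n" if "j < num_cells K" for j
    proof
      assume "j < n"
      then have "\<not> ?P j"
        unfolding n_def by (rule not_less_Least)
      then obtain j' where "j' < num_cells K" "filt K (cell_at K j') \<le> t" "j \<le> j'"
        by (auto simp: not_less)
      then show "filt K (cell_at K j) \<le> t"
        using filt_mono [OF cell_order] order_trans by blast
    qed (use P that in blast)
  qed
qed

section \<open>Linear independence of the surviving classes\<close>

lemma surviving_subset: "surviving K R q t \<subseteq> {..<num_cells K}"
  by (auto simp: surviving_def intervals_def positive_def)

lemma finite_surviving: "finite (surviving K R q t)"
  using surviving_subset finite_subset by blast

text \<open>If a relation bounds in the sublevel complex, it is a combination of columns of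
  \<open>R\<close> whose indices lie there. Its last nonzero coordinate is then the low of such a
  column, so the corresponding interval has already died by time \<open>t\<close>.\<close>

lemma surviving_independent:
  assumes B: "(\<lambda>\<sigma>. \<Sum>v\<in>surviving K R q t. c v * column_chain K V v \<sigma>) \<in> boundaries K q (sublevel K t)"
    and v: "v \<in> surviving K R q t"
  shows "c v = 0"
proof (rule ccontr)
  assume "c v \<noteq> 0"
  let ?S = "surviving K R q t"
  define W where "W = {v \<in> ?S. c v \<noteq> 0}"
  define m where "m = Max W"
  \<comment> \<open>The coordinates of the relation. By unitriangularity of \<open>V\<close> the
    last nonzero one sits at \<open>m\<close>, the largest index with a nonzero coefficient.\<close>
  define F where "F = (\<lambda>r. \<Sum>v\<in>?S. c v * V $$ (r, v))"
  have "finite W" "W \<noteq> {}"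
    using v \<open>c v \<noteq> 0\<close> finite_surviving by (auto simp: W_def)
  then have m: "m \<in> W" and le: "\<And>v. v \<in> W \<Longrightarrow> v \<le> m"
    by (auto simp: m_def)
  then have mS: "m \<in> ?S" "c m \<noteq> 0" "m < num_cells K"
    using surviving_subset by (auto simp: W_def)
  have "F m = (\<Sum>v\<in>{m}. c v * V $$ (m, v))"
    unfolding F_def
  proof (rule sum.mono_neutral_right)
    show "\<forall>v\<in>?S - {m}. c v * V $$ (m, v) = 0"
    proof
      fix v assume "v \<in> ?S - {m}"
      then have "c v = 0 \<or> v < m"
        using le [of v] by (cases "c v = 0") (auto simp: W_def)
      then show "c v * V $$ (m, v) = 0"
        using V_below_diag [OF mS(3)] by auto
    qed
  qed (use finite_surviving mS in auto)
  then have Fm: "F m \<noteq> 0"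
    using mS V_diag by simp
  have F0: "F r = 0" if "m < r" "r < num_cells K" for r
    unfolding F_def
  proof (intro sum.neutral ballI)
    fix v assume "v \<in> ?S"
    then have "c v = 0 \<or> v < r"
      using le [of v] that(1) by (cases "c v = 0") (auto simp: W_def)
    then show "c v * V $$ (r, v) = 0"
      using V_below_diag [OF that(2)] by auto
  qed
  obtain n where n: "n \<le> num_cells K" "\<And>j. j < num_cells K \<Longrightarrow> filt K (cell_at K j) \<le> t \<longleftrightarrow> j < n"
    using sublevel_initial_segment by blast
  obtain x where x: "x \<in> chains K (q + 1) (sublevel K t)"
    and bx: "cellular_boundary K x = (\<lambda>\<sigma>. \<Sum>v\<in>?S. c v * column_chain K V v \<sigma>)"
    using B unfolding boundaries_def image_iff by (metis (no_types, lifting))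
  have "(\<exists>j<n. \<sigma> = cell_at K j) \<and> cell_dim K \<sigma> = q + 1" if "x \<sigma> \<noteq> 0" for \<sigma>
  proof -
    have \<sigma>: "\<sigma> \<in> cells K" "filt K \<sigma> \<le> t" "cell_dim K \<sigma> = q + 1"
      using chainsD [OF x that] by (auto simp: sublevel_def)
    then show ?thesis
      using cells_cell_at [OF cell_order \<sigma>(1)] n(2) by metis
  qed
  then obtain y where y: "x = (\<lambda>\<sigma>. \<Sum>j<n. y j * column_chain K V j \<sigma>)"
    using column_expansion [OF n(1), of x "q + 1"] by blast
  have F: "(\<Sum>j<n. y j * R $$ (r, j)) = F r" if "r < num_cells K" for r
    using cellular_boundary_expansion [OF n(1) that, of y] that
    by (simp add: F_def bx y [symmetric] column_chain_cell_at [OF cell_order])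
  obtain j\<^sub>0 where j0: "j\<^sub>0 < n" "y j\<^sub>0 * R $$ (m, j\<^sub>0) \<noteq> 0"
    using Fm F [OF mS(3)] sum.neutral [of "{..<n}" "\<lambda>j. y j * R $$ (m, j)"] by (metis lessThan_iff)
  have "col R j\<^sub>0 \<noteq> 0\<^sub>v (dim_row R)"
    using zero_col_entry [of R j\<^sub>0 m] j0 n(1) mS reduction_dim by auto
  then obtain j where j: "j < n" "col R j \<noteq> 0\<^sub>v (dim_row R)" "(\<Sum>l<n. y l * R $$ (low R j, l)) \<noteq> 0"
    "\<And>r. low R j < r \<Longrightarrow> r < dim_row R \<Longrightarrow> (\<Sum>l<n. y l * R $$ (r, l)) = 0"
    using reduced_lincomb_low [OF reduced_R, of n j\<^sub>0 y] j0 n(1) reduction_dim by auto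
  have lowN: "low R j < num_cells K"
    using low_nonzero(1) [of j R] j n(1) reduction_dim by simp
  \<comment> \<open>Both are the position of the last nonzero entry of one vector, computed once
    from columns of \<open>R\<close> and once from columns of \<open>V\<close>.\<close>
  have "low R j = m"
    using j(3,4) F lowN F0 Fm mS(3) reduction_dim by (metis linorder_neqE_nat)
  then have "(m, j) \<in> persistence_pairs K R"
    using j n(1) reduction_dim by (auto simp: persistence_pairs_def)
  then have "death K R m = ereal (filt K (cell_at K j))"
    by (rule death_pair [OF reduced_R reduction_dim(3,4)])
  moreover have "filt K (cell_at K j) \<le> t"
    using j(1) n by simp
  ultimately show False
    using mS(1) by (simp add: surviving_def)
qed

text \<open>Trades the equation between classes for a condition on chains, where coefficients can be
  added and compared.\<close>

lemma transition_equation_iff: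
  assumes u: "positive K R u" "cell_dim K (cell_at K u) = q" "birth K u < t"
  shows "inclusion_map K q (sublevel K t) (homology_class K q (strict_sublevel K t) (column_chain K V u))
        = class_lincomb K q (sublevel K t) w (surviving K R q t)
            (\<lambda>v. homology_class K q (sublevel K t) (column_chain K V v)) \<longleftrightarrow>
      (\<lambda>\<sigma>. column_chain K V u \<sigma> - (\<Sum>v\<in>surviving K R q t. w v * column_chain K V v \<sigma>)) \<in> boundaries K q (sublevel K t)"
proof -
  have "strict_sublevel K t \<subseteq> sublevel K t"
    by (auto simp: strict_sublevel_def sublevel_def)
  moreover have "column_chain K V v \<in> cycles K q (sublevel K t)" if "v \<in> surviving K R q t" for v
    by (rule positive_cycles_sublevel) (use that in \<open>auto simp: surviving_def intervals_def\<close>)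
  moreover have "column_chain K V u \<in> cycles K q (sublevel K t)"
    by (rule positive_cycles_sublevel) (use u in auto)
  ultimately show ?thesis
    by (simp add: inclusion_map_homology_class positive_cycles_strict_sublevel [OF u]
        class_lincomb_homology_class homology_class_eq_iff)
qed

text \<open>Subtracting two solutions leaves a relation among surviving cycles, which is trivial;
  off the survivors both are zero by convention. So any solution is the one selected by the definite
  description.\<close>

lemma transition_coeffs_eqI:
  assumes u: "positive K R u" "cell_dim K (cell_at K u) = q" "birth K u < t"
    and w: "\<And>v. v \<notin> surviving K R q t \<Longrightarrow> w v = 0"
    and B: "(\<lambda>\<sigma>. column_chain K V u \<sigma> - (\<Sum>v\<in>surviving K R q t. w v * column_chain K V v \<sigma>)) \<in> boundaries K q (sublevel K t)"
  shows "transition_coeffs K R V q t u = w"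
  unfolding transition_coeffs_def transition_equation_iff [OF u]
proof (rule the_equality)
  fix w' assume w': "(\<forall>v. v \<notin> surviving K R q t \<longrightarrow> w' v = 0) \<and>
    (\<lambda>\<sigma>. column_chain K V u \<sigma> - (\<Sum>v\<in>surviving K R q t. w' v * column_chain K V v \<sigma>)) \<in> boundaries K q (sublevel K t)"
  have "(\<lambda>\<sigma>. \<Sum>v\<in>surviving K R q t. (w v - w' v) * column_chain K V v \<sigma>) \<in> boundaries K q (sublevel K t)"
    using boundaries_diff [OF conjunct2 [OF w'] B] by (simp add: left_diff_distrib sum_subtractf)
  then have "w v - w' v = 0" if "v \<in> surviving K R q t" for v
    using that by (rule surviving_independent)
  then show "w' = w"
    using w w' by (intro ext) (metis eq_iff_diff_eq_0)
qed (use w B in blast)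

section \<open>Existence of the transition coefficients\<close>

context
  assumes incidence_dim: "\<And>\<sigma> \<tau>. \<sigma> \<in> cells K \<Longrightarrow> \<tau> \<in> cells K \<Longrightarrow> cell_dim K \<sigma> \<noteq> cell_dim K \<tau> + 1 \<Longrightarrow> incidence K \<sigma> \<tau> = 0"
    and incidence_incidence: "\<And>\<sigma> \<rho>. \<sigma> \<in> cells K \<Longrightarrow> \<rho> \<in> cells K \<Longrightarrow> (\<Sum>\<tau>\<in>cells K. incidence K \<tau> \<rho> * incidence K \<sigma> \<tau>) = 0"
begin

text \<open>Nonzero incidence forces codimension one. This determines the dimension of the cell that
  kills a given class.\<close>

lemma cellular_boundary_chains:
  fixes c :: "'a set \<Rightarrow> 'k"
  assumes "c \<in> chains K p A"
  shows "cellular_boundary K c \<sigma> \<noteq> 0 \<Longrightarrow> \<sigma> \<in> cells K \<and> p = cell_dim K \<sigma> + 1"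
proof -
  assume nz: "cellular_boundary K c \<sigma> \<noteq> 0"
  then have "\<sigma> \<in> cells K" "(\<Sum>\<tau>\<in>cells K. c \<tau> * of_int (incidence K \<tau> \<sigma>)) \<noteq> 0"
    by (auto simp: cellular_boundary_def split: if_splits)
  moreover from this(2) obtain \<tau> where "\<tau> \<in> cells K" "c \<tau> * of_int (incidence K \<tau> \<sigma>) \<noteq> 0"
    by (rule sum.not_neutral_contains_not_neutral)
  moreover from this(2) have "cell_dim K \<tau> = p" "incidence K \<tau> \<sigma> \<noteq> 0"
    using chainsD(3) [OF assms, of \<tau>] by auto
  ultimately show "\<sigma> \<in> cells K \<and> p = cell_dim K \<sigma> + 1"
    using incidence_dim by blast
qed

text \<open>The boundary of the expansion is the same combination of columns of \<open>R\<close>. If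
  a nonzero column took part, the largest low among those columns would give a nonzero
  entry.\<close>

lemma cycle_expansion:
  assumes n: "n \<le> num_cells K"
    and c: "\<And>\<sigma>. c \<sigma> \<noteq> 0 \<Longrightarrow> (\<exists>j<n. \<sigma> = cell_at K j) \<and> cell_dim K \<sigma> = p"
    and cyc: "cellular_boundary K c = (\<lambda>_. 0)"
  obtains y where "c = (\<lambda>\<sigma>. \<Sum>j<n. y j * column_chain K V j \<sigma>)"
    "\<And>j. j < n \<Longrightarrow> y j \<noteq> 0 \<Longrightarrow> positive K R j \<and> cell_dim K (cell_at K j) = p"
proof -
  obtain y where y: "c = (\<lambda>\<sigma>. \<Sum>j<n. y j * column_chain K V j \<sigma>)"
    and dim: "\<And>j. j < n \<Longrightarrow> y j \<noteq> 0 \<Longrightarrow> cell_dim K (cell_at K j) = p"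
    using column_expansion [OF n, of c p] c by blast
  have zero: "(\<Sum>l<n. y l * R $$ (r, l)) = 0" if "r < num_cells K" for r
    using cellular_boundary_expansion [OF n that, of y] cyc by (simp add: y [symmetric])
  have "positive K R j" if j: "j < n" "y j \<noteq> 0" for j
  proof (rule ccontr)
    assume "\<not> positive K R j"
    then have "col R j \<noteq> 0\<^sub>v (dim_row R)"
      using j n reduction_dim by (auto simp: positive_def)
    then obtain l where "l < n" "col R l \<noteq> 0\<^sub>v (dim_row R)" "(\<Sum>i<n. y i * R $$ (low R l, i)) \<noteq> 0"
      using reduced_lincomb_low [OF reduced_R, of n j y] j n reduction_dim by auto
    then show False
      using zero low_nonzero(1) [of l R] n reduction_dim by auto
  qed
  then show thesis
    using that y dim by blast
qed

text \<open>Strong induction on the birth index. The claim covers every positive cell born before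
  \<open>t\<close>, including those whose interval is empty, because their birth cycles may appear
  in the remainder.\<close>

lemma transition_exists:
  assumes "positive K R u" "cell_dim K (cell_at K u) = q" "birth K u < t"
  shows "\<exists>w. (\<lambda>\<sigma>. column_chain K V u \<sigma> - (\<Sum>v\<in>surviving K R q t. w v * column_chain K V v \<sigma>)) \<in> boundaries K q (sublevel K t)"
  using assms
proof (induction u rule: less_induct)
  case (less u)
  let ?S = "surviving K R q t"
  have u: "u < num_cells K"
    using less.prems by (simp add: positive_def)
  show ?case
  proof (cases "ereal t < death K R u")
    case True
    have "ereal (birth K u) < death K R u"
      by (rule less_trans [OF _ True]) (simp add: less.prems(3))
    then have "u \<in> ?S"
      using less.prems True by (simp add: surviving_def intervals_def)
    \<comment> \<open>A survivor is itself a basis cycle, and its indicator function serves as the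
      coefficients.\<close>
    then have "(\<Sum>v\<in>?S. (if v = u then 1 else 0) * column_chain K V v \<sigma>) = column_chain K V u \<sigma>" for \<sigma>
      using finite_surviving by (simp add: if_distrib [where f="\<lambda>x. x * _"] cong: if_cong)
    then show ?thesis
      using boundaries_zero by (intro exI [where x="\<lambda>v. if v = u then 1 else 0"]) simp
  next
    case False
    then have "death K R u \<le> ereal t"
      by simp
    then have "death K R u < \<infinity>"
      by (rule le_less_trans) simp
    then obtain j where j: "(u, j) \<in> persistence_pairs K R" "death K R u = ereal (filt K (cell_at K j))"
      using finite_death_pair [OF reduced_R reduction_dim(3,4)] by blast
    have jN: "j < num_cells K" and col: "col R j \<noteq> 0\<^sub>v (dim_row R)" and low: "low R j = u"
      using j(1) reduction_dim by (auto simp: persistence_pairs_def)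
    have ft: "filt K (cell_at K j) \<le> t"
      using False j(2) by simp
    \<comment> \<open>This is column \<open>j\<close> of \<open>R\<close> as a chain: a boundary in
      the sublevel complex whose last nonzero entry is at \<open>u\<close>.\<close>
    define b where "b = cellular_boundary K (column_chain K V j)"
    have b_at: "b (cell_at K r) = R $$ (r, j)" if "r < num_cells K" for r
      using that jN by (simp add: b_def cellular_boundary_V column_chain_cell_at [OF cell_order])
    have bu: "b (cell_at K u) \<noteq> 0"
      using low_nonzero(2) [of j R] b_at [OF u] low jN col reduction_dim by simp
    have b0: "b (cell_at K r) = 0" if "u < r" "r < num_cells K" for r
      using low_nonzero(3) [of j R r] b_at that low jN col reduction_dim by simp
    let ?p = "cell_dim K (cell_at K j)"
    have chain_j: "column_chain K V j \<in> chains K ?p (sublevel K t)"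
      using column_chain_V_chains [OF jN refl] ft by (simp add: sublevel_def)
    \<comment> \<open>The entry at \<open>u\<close> of this boundary is nonzero, so cell
      \<open>j\<close> is one dimension above cell \<open>u\<close>.\<close>
    have p: "?p = q + 1"
      using cellular_boundary_chains [OF chain_j, of "cell_at K u"] bu less.prems(2) by (simp add: b_def)
    have b_dim: "\<sigma> \<in> cells K \<and> cell_dim K \<sigma> = q" if "b \<sigma> \<noteq> 0" for \<sigma>
      using cellular_boundary_chains [OF chain_j, of \<sigma>] that p by (simp add: b_def)
    have b_bd: "b \<in> boundaries K q (sublevel K t)"
      using chain_j p by (auto simp: b_def boundaries_def)
    \<comment> \<open>The entry of \<open>V\<close> at \<open>(u, u)\<close> is 1, so this multiple
      of \<open>b\<close> cancels it and leaves \<open>c\<close> supported strictly before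
      \<open>u\<close>.\<close>
    define a where "a = inverse (b (cell_at K u))"
    define c where "c = (\<lambda>\<sigma>. column_chain K V u \<sigma> - a * b \<sigma>)"
    have c_supp: "(\<exists>l<u. \<sigma> = cell_at K l) \<and> cell_dim K \<sigma> = q" if nz: "c \<sigma> \<noteq> 0" for \<sigma>
    proof -
      have "(\<exists>l\<le>u. \<sigma> = cell_at K l) \<and> cell_dim K \<sigma> = q"
      proof (cases "column_chain K V u \<sigma> = 0")
        case True
        then have "b \<sigma> \<noteq> 0" using nz by (auto simp: c_def)
        moreover from b_dim [OF this] obtain r where "r < num_cells K" "\<sigma> = cell_at K r"
          by (meson cells_cell_at [OF cell_order])
        ultimately show ?thesis
          using b0 [of r] b_dim [of \<sigma>] by (metis not_le)
      next
        case False
        then show ?thesis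
          using column_chain_V_support [OF u False] less.prems(2) by metis
      qed
      moreover have "c (cell_at K u) = 0"
        using bu u V_diag by (simp add: c_def a_def column_chain_cell_at [OF cell_order])
      ultimately show ?thesis
        using nz by (metis le_neq_implies_less)
    qed
    \<comment> \<open>\<open>column_chain K V u\<close> is a birth cycle, and \<open>b\<close> is a
      cycle because the boundary squares to zero.\<close>
    have c_cyc: "cellular_boundary K c = (\<lambda>_. 0)"
      using cellular_boundary_boundary [OF incidence_incidence, of "column_chain K V j"] positive_cycle [OF less.prems(1)]
      by (simp add: c_def cellular_boundary_diff cellular_boundary_scale b_def)
    obtain y where y: "c = (\<lambda>\<sigma>. \<Sum>l<u. y l * column_chain K V l \<sigma>)"
      and y_pos: "\<And>l. l < u \<Longrightarrow> y l \<noteq> 0 \<Longrightarrow> positive K R l \<and> cell_dim K (cell_at K l) = q"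
      using cycle_expansion [OF _ c_supp c_cyc] u by auto
    define L where "L = {l. l < u \<and> y l \<noteq> 0}"
    have "\<forall>l\<in>L. \<exists>w. (\<lambda>\<sigma>. column_chain K V l \<sigma> - (\<Sum>v\<in>?S. w v * column_chain K V v \<sigma>)) \<in> boundaries K q (sublevel K t)"
    proof
      fix l assume "l \<in> L"
      then have l: "l < u" "y l \<noteq> 0" by (simp_all add: L_def)
      show "\<exists>w. (\<lambda>\<sigma>. column_chain K V l \<sigma> - (\<Sum>v\<in>?S. w v * column_chain K V v \<sigma>)) \<in> boundaries K q (sublevel K t)"
      proof (rule less.IH [OF l(1)])
        show "birth K l < t"
          using less.prems(3) filt_mono [OF cell_order, of l u] l(1) u by (simp add: birth_def)
      qed (use y_pos [OF l] in simp_all)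
    qed
    \<comment> \<open>Coefficients for each earlier birth cycle in the expansion of
      \<open>c\<close>, to be combined with the weights \<open>y\<close>.\<close>
    from bchoice [OF this] obtain W where W: "\<forall>l\<in>L.
        (\<lambda>\<sigma>. column_chain K V l \<sigma> - (\<Sum>v\<in>?S. W l v * column_chain K V v \<sigma>)) \<in> boundaries K q (sublevel K t)"
      by blast
    have sumL: "(\<Sum>l<u. y l * column_chain K V l \<sigma>) = (\<Sum>l\<in>L. y l * column_chain K V l \<sigma>)" for \<sigma>
      by (rule sum.mono_neutral_right) (auto simp: L_def)
    have "(\<lambda>\<sigma>. \<Sum>l\<in>L. y l * (column_chain K V l \<sigma> - (\<Sum>v\<in>?S. W l v * column_chain K V v \<sigma>))) \<in> boundaries K q (sublevel K t)"
      by (rule boundaries_lincomb) (rule bspec [OF W])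
    moreover have "(\<Sum>l\<in>L. y l * (column_chain K V l \<sigma> - (\<Sum>v\<in>?S. W l v * column_chain K V v \<sigma>)))
          = c \<sigma> - (\<Sum>v\<in>?S. (\<Sum>l\<in>L. y l * W l v) * column_chain K V v \<sigma>)" for \<sigma>
    proof -
      have "(\<Sum>v\<in>?S. (\<Sum>l\<in>L. y l * W l v) * column_chain K V v \<sigma>)
            = (\<Sum>l\<in>L. y l * (\<Sum>v\<in>?S. W l v * column_chain K V v \<sigma>))"
        unfolding sum_distrib_right sum_distrib_left by (subst sum.swap) (simp add: mult.assoc)
      then show ?thesis
        by (simp add: y sumL right_diff_distrib sum_subtractf)
    qed
    ultimately have "(\<lambda>\<sigma>. c \<sigma> - (\<Sum>v\<in>?S. (\<Sum>l\<in>L. y l * W l v) * column_chain K V v \<sigma>)) \<in> boundaries K q (sublevel K t)"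
      by simp
    \<comment> \<open>Restore the subtracted multiple of \<open>b\<close>; being a boundary, it does
      not affect the class.\<close>
    from boundaries_add [OF this boundaries_scale [OF b_bd, of a]]
    have "(\<lambda>\<sigma>. column_chain K V u \<sigma> - (\<Sum>v\<in>?S. (\<Sum>l\<in>L. y l * W l v) * column_chain K V v \<sigma>)) \<in> boundaries K q (sublevel K t)"
      by (simp add: c_def algebra_simps)
    then show ?thesis by (rule exI [where x="\<lambda>v. \<Sum>l\<in>L. y l * W l v"])
  qed
qed

lemma transition_coeffs:
  assumes u: "positive K R u" "cell_dim K (cell_at K u) = q" "birth K u < t"
  shows "\<And>v. v \<notin> surviving K R q t \<Longrightarrow> transition_coeffs K R V q t u v = 0"
    and "(\<lambda>\<sigma>. column_chain K V u \<sigma> - (\<Sum>v\<in>surviving K R q t. transition_coeffs K R V q t u v * column_chain K V v \<sigma>))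
           \<in> boundaries K q (sublevel K t)"
proof -
  obtain w where w: "(\<lambda>\<sigma>. column_chain K V u \<sigma> - (\<Sum>v\<in>surviving K R q t. w v * column_chain K V v \<sigma>)) \<in> boundaries K q (sublevel K t)"
    using transition_exists [OF u] by blast
  \<comment> \<open>Truncation to the survivors enforces the default value 0 on which uniqueness
    depends; the sum is unaffected.\<close>
  define w' where "w' = (\<lambda>v. if v \<in> surviving K R q t then w v else 0)"
  have B: "(\<lambda>\<sigma>. column_chain K V u \<sigma> - (\<Sum>v\<in>surviving K R q t. w' v * column_chain K V v \<sigma>)) \<in> boundaries K q (sublevel K t)"
    using w by (simp add: w'_def cong: sum.cong)
  have eq: "transition_coeffs K R V q t u = w'"
    by (rule transition_coeffs_eqI [OF u _ B]) (simp add: w'_def)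
  show "\<And>v. v \<notin> surviving K R q t \<Longrightarrow> transition_coeffs K R V q t u v = 0"
    by (simp add: eq w'_def)
  show "(\<lambda>\<sigma>. column_chain K V u \<sigma> - (\<Sum>v\<in>surviving K R q t. transition_coeffs K R V q t u v * column_chain K V v \<sigma>))
           \<in> boundaries K q (sublevel K t)"
    unfolding eq by (rule B)
qed

end

end


subsection \<open>Adding a multiple of a birth cycle\<close>

text \<open>The column addition is right multiplication by an elementary matrix, so it acts on
  \<open>R\<close> by adding \<open>a\<close> times the zero column \<open>k\<close>. The order
  \<open>k < i\<close> keeps the matrix unitriangular, and equal dimensions keep it dimension
  preserving.\<close>

lemma reduction_addcol:
  assumes red: "reduction K R V" and ki: "k < i" and pos: "positive K R k" "positive K R i"
    and dim: "cell_dim K (cell_at K k) = cell_dim K (cell_at K i)"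
  shows "boundary_matrix K * addcol a i k V = R" "reduction K R (addcol a i k V)"
proof -
  let ?N = "num_cells K"
  have i: "i < ?N" "k < ?N"
    using pos by (auto simp: positive_def)
  have V: "V \<in> carrier_mat ?N ?N" and R: "R = boundary_matrix K * V" and ut: "upper_triangular V"
    and diag: "\<And>j. j < ?N \<Longrightarrow> V $$ (j, j) = 1"
    and V_dim: "\<And>r j. r < ?N \<Longrightarrow> j < ?N \<Longrightarrow> V $$ (r, j) \<noteq> 0 \<Longrightarrow> cell_dim K (cell_at K r) = cell_dim K (cell_at K j)"
    using red unfolding reduction_def by blast+
  have B: "boundary_matrix K \<in> carrier_mat ?N ?N"
    by (simp add: boundary_matrix_def)
  have RN: "R \<in> carrier_mat ?N ?N"
    unfolding R using B V by (rule mult_carrier_mat)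
  have E: "addrow_mat ?N a k i \<in> carrier_mat ?N ?N"
    by simp
  have "boundary_matrix K * addcol a i k V = boundary_matrix K * (V * addrow_mat ?N a k i)"
    by (simp add: addcol_mat [OF V i(2)])
  also have "\<dots> = R * addrow_mat ?N a k i"
    unfolding R by (rule assoc_mult_mat [OF B V E, symmetric])
  also have "\<dots> = addcol a i k R"
    by (rule addcol_mat [OF RN i(2), symmetric])
  also have "\<dots> = R"
  proof (rule eq_matI)
    fix r j assume "r < dim_row R" "j < dim_col R"
    moreover have "R $$ (r, k) = 0" if "r < dim_row R"
      using zero_col_entry [of R k r] pos(1) RN that i by (simp add: positive_def)
    ultimately show "addcol a i k R $$ (r, j) = R $$ (r, j)"
      by simp
  qed simp_all
  finally show eq: "boundary_matrix K * addcol a i k V = R" .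
  have below: "V $$ (r, j) = 0" if "r < ?N" "j < r" for r j
    using ut V that unfolding upper_triangular_def by auto
  have "upper_triangular (addcol a i k V)"
    unfolding upper_triangular_def
  proof (intro allI impI)
    fix r j assume "r < dim_row (addcol a i k V)" "j < r"
    then show "addcol a i k V $$ (r, j) = 0"
      using V ki below by simp
  qed
  moreover have "addcol a i k V $$ (j, j) = 1" if "j < ?N" for j
    using V that ki below diag by simp
  moreover have "cell_dim K (cell_at K r) = cell_dim K (cell_at K j)"
    if "r < ?N" "j < ?N" "addcol a i k V $$ (r, j) \<noteq> 0" for r j
  proof (cases "V $$ (r, j) = 0")
    case True
    then have "j = i" "V $$ (r, k) \<noteq> 0"
      using that V by (auto split: if_splits)
    then show ?thesis
      using V_dim [OF that(1) i(2)] dim by simp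
  qed (rule V_dim [OF that(1,2)])
  moreover have "addcol a i k V \<in> carrier_mat ?N ?N"
    using V by (intro carrier_matI) simp_all
  moreover have "reduced R"
    using red unfolding reduction_def by blast
  ultimately show "reduction K R (addcol a i k V)"
    unfolding reduction_def eq by blast
qed

lemma column_chain_addcol:
  assumes ord: "compatible_cell_order K" and V: "V \<in> carrier_mat (num_cells K) (num_cells K)" and l: "l < num_cells K"
  shows "column_chain K (addcol a i k V) l =
         (\<lambda>\<sigma>. (if l = i then a * column_chain K V k \<sigma> else 0) + column_chain K V l \<sigma>)"
  by (rule chain_eqI [OF ord])
     (use V l in \<open>simp_all add: column_chain_outside [OF ord] column_chain_cell_at [OF ord]\<close>)

section \<open>Effect on the transition coefficients and on the graph\<close>

lemma death_eq_real:
  assumes "ereal b < death K R u" "death K R u < \<infinity>"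
  shows "death K R u = ereal (real_of_ereal (death K R u))"
  using assms by (cases "death K R u") auto

text \<open>Only the cycle of \<open>i\<close> changes, by \<open>a\<close> times the basis cycle of
  \<open>k\<close>. Raising the coefficient at \<open>k\<close> by \<open>a\<close> absorbs this on
  the level of chains, and uniqueness identifies the result as the new coefficients.\<close>

lemma transition_coeff_addcol:
  fixes V :: "'k::field mat"
  assumes K: "filtered_cw_complex K" and red: "reduction K R V" and ki: "k < i"
    and u: "i \<in> intervals K R q" "death K R i < \<infinity>"
    and v: "k \<in> intervals K R q" "death K R i < death K R k"
  shows "transition_coeff K R (addcol a i k V) q i k = transition_coeff K R V q i k + a"
proof -
  have cw: "finite_cw_complex K" and or: "oriented_cells K" and inc: "incidence_coefficients K"
    and ord: "compatible_cell_order K"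
    using K by (auto simp: filtered_cw_complex_def)
  define t where "t = real_of_ereal (death K R i)"
  let ?V' = "addcol a i k V"
  have pos: "positive K R i" "cell_dim K (cell_at K i) = q" "positive K R k" "cell_dim K (cell_at K k) = q"
    using u v by (auto simp: intervals_def)
  have iN: "i < num_cells K" "k < num_cells K"
    using pos by (auto simp: positive_def)
  have t: "death K R i = ereal t"
    unfolding t_def by (rule death_eq_real [where b="birth K i", OF _ u(2)]) (use u(1) in \<open>simp add: intervals_def\<close>)
  have bi: "birth K i < t"
    using u(1) t by (simp add: intervals_def)
  \<comment> \<open>The smaller index is born no later than \<open>i\<close>, hence before
    \<open>t\<close>; this is the remaining condition for \<open>k\<close> to be a survivor.\<close>
  have bk: "birth K k < t"
    using filt_mono [OF ord, of k i] ki iN bi by (simp add: birth_def)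
  let ?S = "surviving K R q t"
  \<comment> \<open>The interval of \<open>i\<close> dies exactly at \<open>t\<close>, so the
    modified cycle is not part of the basis.\<close>
  have kS: "k \<in> ?S" and iS: "i \<notin> ?S"
    using v bk t by (auto simp: surviving_def)
  have red': "reduction K R ?V'"
    by (rule reduction_addcol [OF red ki pos(3,1)]) (simp add: pos)
  have V: "V \<in> carrier_mat (num_cells K) (num_cells K)"
    using red by (simp add: reduction_def)
  define w where "w = transition_coeffs K R V q t i"
  have inc_dim: "incidence K \<sigma> \<tau> = 0" if "\<sigma> \<in> cells K" "\<tau> \<in> cells K" "cell_dim K \<sigma> \<noteq> cell_dim K \<tau> + 1" for \<sigma> \<tau>
    using inc that unfolding incidence_coefficients_def by blast
  note w = transition_coeffs [OF ord red inc_dim sum_incidence_incidence [OF cw or inc] pos(1,2) bi, folded w_def]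
  have Z': "column_chain K ?V' i = (\<lambda>\<sigma>. a * column_chain K V k \<sigma> + column_chain K V i \<sigma>)"
    using column_chain_addcol [OF ord V iN(1)] by simp
  have Z: "column_chain K ?V' v = column_chain K V v" if "v \<in> ?S" for v
  proof -
    have "v < num_cells K" "v \<noteq> i"
      using that iS surviving_subset [OF ord red, of q t] by blast+
    then show ?thesis
      using column_chain_addcol [OF ord V, of v a i k] by simp
  qed
  have "transition_coeffs K R ?V' q t i = (\<lambda>v. w v + (if v = k then a else 0))"
  proof (rule transition_coeffs_eqI [OF ord red' pos(1,2) bi])
    show "w v + (if v = k then a else 0) = 0" if "v \<notin> ?S" for v
      using w(1) that kS by auto
    have "(\<Sum>v\<in>?S. (w v + (if v = k then a else 0)) * column_chain K ?V' v \<sigma>)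
        = (\<Sum>v\<in>?S. w v * column_chain K V v \<sigma>) + a * column_chain K V k \<sigma>" for \<sigma>
    proof -
      have "(\<Sum>v\<in>?S. (w v + (if v = k then a else 0)) * column_chain K ?V' v \<sigma>)
          = (\<Sum>v\<in>?S. w v * column_chain K V v \<sigma> + (if v = k then a * column_chain K V k \<sigma> else 0))"
        by (rule sum.cong) (auto simp: Z distrib_right)
      also have "\<dots> = (\<Sum>v\<in>?S. w v * column_chain K V v \<sigma>) + a * column_chain K V k \<sigma>"
        using kS finite_surviving [OF ord red] by (simp add: sum.distrib)
      finally show ?thesis .
    qed
    then show "(\<lambda>\<sigma>. column_chain K ?V' i \<sigma> - (\<Sum>v\<in>?S. (w v + (if v = k then a else 0)) * column_chain K ?V' v \<sigma>))
        \<in> boundaries K q (sublevel K t)"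
      using w(2) by (simp add: Z' algebra_simps)
  qed
  then show ?thesis
    by (simp add: transition_coeff_def t_def [symmetric] w_def)
qed

theorem corollary3p8:
  fixes K :: "'a filtered_cw" and R V :: "'k::field mat" and q k i :: nat
  assumes K: "filtered_cw_complex K"
    and RV: "reduction K R V"
    and ki: "k < i"
    and pos: "positive K R k" "positive K R i"
    and dims: "cell_dim K (cell_at K k) = q" "cell_dim K (cell_at K i) = q"
    and u: "i \<in> intervals K R q" "death K R i < \<infinity>"
    and v: "k \<in> intervals K R q" "death K R i < death K R k"
  shows "(\<forall>a. let V' = addcol a i k V; R' = boundary_matrix K * V' in
            reduction K R' V' \<and> R' = R \<and>
            persistence_pairs K R' = persistence_pairs K R \<and>
            (\<forall>p. barcode K R' p = barcode K R p)) \<and>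
         (\<exists>a. transition_support K R (addcol a i k V) q \<noteq> transition_support K R V q) \<and>
         (transition_coeff K R V q i k \<noteq> 0 \<longrightarrow>
            (i, k) \<in> parcs (pairing_graph K R V q) \<and>
            (i, k) \<notin> parcs (pairing_graph K R (addcol (- transition_coeff K R V q i k) i k V) q)) \<and>
         (transition_coeff K R V q i k = 0 \<longrightarrow>
            (i, k) \<notin> parcs (pairing_graph K R V q) \<and>
            (\<forall>a. a \<noteq> 0 \<longrightarrow> (i, k) \<in> parcs (pairing_graph K R (addcol a i k V) q)))"
proof -
  have ord: "compatible_cell_order K"
    using K by (simp add: filtered_cw_complex_def)
  define w where "w = transition_coeff K R V q i k"
  have coeff: "transition_coeff K R (addcol a i k V) q i k = w + a" for a
    unfolding w_def by (rule transition_coeff_addcol [OF K RV ki u v])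
  define t where "t = real_of_ereal (death K R i)"
  have t: "death K R i = ereal t"
    unfolding t_def by (rule death_eq_real [where b="birth K i", OF _ u(2)]) (use u(1) in \<open>simp add: intervals_def\<close>)
  have bi: "birth K i < t"
    using u(1) t by (simp add: intervals_def)
  have bk: "birth K k < t"
    using filt_mono [OF ord, of k i] ki pos(2) bi by (simp add: birth_def positive_def)
  \<comment> \<open>All other conditions on an edge involve only \<open>R\<close> and the
    filtration, and they hold for this pair; the same is true of the support below.\<close>
  have edge: "(i, k) \<in> parcs (pairing_graph K R V\<^sub>1 q) \<longleftrightarrow> transition_coeff K R V\<^sub>1 q i k \<noteq> 0" for V\<^sub>1
    using u v bk t by (simp add: pairing_graph_def)
  have supp: "(i, k) \<in> transition_support K R V\<^sub>1 q \<longleftrightarrow> transition_coeff K R V\<^sub>1 q i k \<noteq> 0" for V\<^sub>1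
    using u v bk bi t by (auto simp: transition_support_def dying_def surviving_def)
  \<comment> \<open>The coefficient is \<open>w + a\<close>: the value 1 makes a zero coefficient
    nonzero, and \<open>- w\<close> makes a nonzero one vanish. Either way membership of
    \<open>(i, k)\<close> flips.\<close>
  have "\<exists>a. transition_support K R (addcol a i k V) q \<noteq> transition_support K R V q"
  proof (cases "w = 0")
    case True
    then have "(i, k) \<in> transition_support K R (addcol 1 i k V) q" "(i, k) \<notin> transition_support K R V q"
      by (simp_all add: supp coeff w_def [symmetric])
    then show ?thesis by metis
  next
    case False
    then have "(i, k) \<notin> transition_support K R (addcol (- w) i k V) q" "(i, k) \<in> transition_support K R V q"
      by (simp_all add: supp coeff w_def [symmetric])
    then show ?thesis by metis
  qed
  moreover have "reduction K R (addcol a i k V)" "boundary_matrix K * addcol a i k V = R" for a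
    using reduction_addcol [OF RV ki pos] dims by simp_all
  ultimately show ?thesis
    by (simp add: Let_def edge coeff w_def [symmetric])
qed

end
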